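(* Let $(\mathcal U_n)_{n\ge1}$ be a sequence of taut tree-chains in $\mathbb R^2$ such that (1) for each positive integer $n$, $\mathcal U_{n+1}$ strongly refines $\mathcal U_n$; (2) for each positive integer $n\ge2$, $\operatorname{mesh}(\mathcal U_n)<\frac{\rho}{2^n}$, where $\rho=\min\{d(U,V)\mid U\cap V=\emptyset,\ U,V\in\mathcal U_1\}$; (3) $(\mathcal U_n)$ follows a fixed-point-free pattern. Then $X=\bigcap_{n=1}^\infty\left(\bigcup\mathcal U_n\right)$ is a tree-like continuum in $\mathbb R^2$ that does not have the fixed-point property. If there is no such sequence (of taut tree-chains in $\mathbb R^2$ satisfying (1), (2) and (3)), then every planar tree-like continuum has the fixed-point property.
   Context: A continuum is a nonempty compact connected metric space. A graph is a continuum that is a union of finitely many arcs, any two of which are either disjoint or intersect in one or both of their end points; a tree is a graph containing no simple closed curve. A space $X$ has the fixed-point property if every continuous $f:X\to X$ has a point $p$ with $f(p)=p$. A tree-chain in a metric space is a (finite) family of open subsets such that the geometric realization of its nerve is a tree. A continuum $X$ is tree-like if each open cover of $X$ can be refined by a finite open cover of $X$ the geometric realization of whose nerve is a tree. A planar continuum is one embedded in $\mathbb R^2$. $d$ is the metric on $\mathbb R^2$, and $d(A_1,A_2)=\inf\{d(a_1,a_2)\mid a_1\in A_1,a_2\in A_2\}$. A family $\mathcal U$ of subsets is taut if for all $U,V\in\mathcal U$ with $U\cap V=\emptyset$ one has $\operatorname{cl}(U)\cap\operatorname{cl}(V)=\emptyset$. The mesh of a family is the supremum of the diameters of its members. $\mathcal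 V$ strongly refines $\mathcal U$ if for each $V\in\mathcal V$ there is $U\in\mathcal U$ with $\operatorname{cl}(V)\subseteq U$. A sequence $(\mathcal U_n)_{n\ge1}$ of finite families of subsets of a metric space follows a fixed-point-free pattern if there are functions $\varphi_n:\mathcal U_{n+1}\to\mathcal U_n$ ($n\ge1$) such that: (D1) for all $U\in\mathcal U_1$, $V\in\mathcal U_2$: $U\cap V\ne\emptyset\Rightarrow\varphi_1(V)\cap U=\emptyset$; (D2) for each positive integer $n$ and all $U\in\mathcal U_{n+2}$, $V\in\mathcal U_{n+1}$: $U\cap V\neq\emptyset\Rightarrow\varphi_{n+1}(U)\cap\varphi_n(V)\ne\emptyset$; (D3) for each positive integer $n$ and all $U,V\in\mathcal U_{n+1}$: $U\cap V\ne\emptyset\Rightarrow\varphi_n(U)\cap\varphi_n(V)\neq\emptyset$. *)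

theory Defs
  imports "HOL-Analysis.Analysis"
begin

section \<open>Continua, graphs and trees\<close>

text \<open>
  A space is a subset of a type of class \<^class>\<open>topological_space\<close>, with the subspace topology.
  The class is not restricted to metric spaces because geometric realizations, defined below, live
  in a function type with the product topology.
\<close>

definition continuum :: "'a::topological_space set \<Rightarrow> bool" where
  "continuum X \<longleftrightarrow> X \<noteq> {} \<and> compact X \<and> connected X \<and> metrizable_space (top_of_set X)"

text \<open>
  Arcs are nondegenerate, so a one-point space is not a graph.
\<close>

definition is_graph :: "'a::topological_space set \<Rightarrow> bool" where
  "is_graph X \<longleftrightarrow> continuum X \<and>
    (\<exists>G. finite G \<and> (\<forall>g\<in>G. arc g) \<and> X = (\<Union>g\<in>G. path_image g) \<and>
      (\<forall>g\<in>G. \<forall>h\<in>G. g \<noteq> h \<longrightarrow>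
        path_image g \<inter> path_image h \<subseteq>
          {pathstart g, pathfinish g} \<inter> {pathstart h, pathfinish h}))"

definition is_tree :: "'a::topological_space set \<Rightarrow> bool" where
  "is_tree X \<longleftrightarrow> is_graph X \<and>
    \<not> (\<exists>c. simple_path c \<and> pathfinish c = pathstart c \<and> path_image c \<subseteq> X)"

definition fixed_point_property :: "'a::topological_space set \<Rightarrow> bool" where
  "fixed_point_property X \<longleftrightarrow>
    (\<forall>f. continuous_on X f \<and> f ` X \<subseteq> X \<longrightarrow> (\<exists>p\<in>X. f p = p))"

section \<open>Nerves, tree-chains and tree-like continua\<close>

text \<open>
  An empty member of the family is not a vertex of the nerve.
\<close>

definition nerve :: "'a set set \<Rightarrow> 'a set set set" where
  "nerve \<U> = {\<sigma>. \<sigma> \<subseteq> \<U> \<and> finite \<sigma> \<and> \<sigma> \<noteq> {} \<and> \<Inter>\<sigma> \<noteq> {}}"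

text \<open>
  Barycentric coordinates. The topology is the product topology of the function type, which
  is the usual topology of the realization when the complex is finite.
\<close>

definition geometric_realization :: "'v set set \<Rightarrow> ('v \<Rightarrow> real) set" where
  "geometric_realization K =
    {t. (\<forall>v. 0 \<le> t v) \<and> {v. t v \<noteq> 0} \<in> K \<and> (\<Sum>v | t v \<noteq> 0. t v) = 1}"

definition tree_chain :: "'a::metric_space set set \<Rightarrow> bool" where
  "tree_chain \<U> \<longleftrightarrow>
    finite \<U> \<and> (\<forall>U\<in>\<U>. open U) \<and> is_tree (geometric_realization (nerve \<U>))"

definition open_cover_of :: "'a::topological_space set \<Rightarrow> 'a set set \<Rightarrow> bool" where
  "open_cover_of X \<C> \<longleftrightarrow> (\<forall>C\<in>\<C>. openin (top_of_set X) C) \<and> \<Union>\<C> = X"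

definition tree_like_continuum :: "'a::topological_space set \<Rightarrow> bool" where
  "tree_like_continuum X \<longleftrightarrow> continuum X \<and>
    (\<forall>\<C>. open_cover_of X \<C> \<longrightarrow>
      (\<exists>\<V>. finite \<V> \<and> open_cover_of X \<V> \<and> (\<forall>V\<in>\<V>. \<exists>C\<in>\<C>. V \<subseteq> C) \<and>
           is_tree (geometric_realization (nerve \<V>))))"

section \<open>Metric notions for families of sets\<close>

text \<open>
  Distances and diameters are extended nonnegative reals: \<^const>\<open>setdist\<close> is 0 as soon as one
  of the sets is empty, and \<^const>\<open>diameter\<close> is meaningful only for bounded sets.
\<close>

definition set_edist :: "'a::metric_space set \<Rightarrow> 'a set \<Rightarrow> ennreal" where
  "set_edist A B = (INF a\<in>A. INF b\<in>B. ennreal (dist a b))"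

definition ediameter :: "'a::metric_space set \<Rightarrow> ennreal" where
  "ediameter A = (SUP x\<in>A. SUP y\<in>A. ennreal (dist x y))"

definition mesh :: "'a::metric_space set set \<Rightarrow> ennreal" where
  "mesh \<U> = (SUP U\<in>\<U>. ediameter U)"

text \<open>
  For a finite family with at least one pair of disjoint members this infimum is a minimum.
  A tree-chain that begins a sequence following a fixed-point-free pattern has such a pair, by the
  first condition on the pattern.
\<close>

definition min_gap :: "'a::metric_space set set \<Rightarrow> ennreal" where
  "min_gap \<U> = Inf {set_edist U V |U V. U \<in> \<U> \<and> V \<in> \<U> \<and> U \<inter> V = {}}"

definition taut :: "'a::topological_space set set \<Rightarrow> bool" where
  "taut \<U> \<longleftrightarrow> (\<forall>U\<in>\<U>. \<forall>V\<in>\<U>. U \<inter> V = {} \<longrightarrow> closure U \<inter> closure V = {})"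

definition strongly_refines :: "'a::topological_space set set \<Rightarrow> 'a set set \<Rightarrow> bool" where
  "strongly_refines \<V> \<U> \<longleftrightarrow> (\<forall>V\<in>\<V>. \<exists>U\<in>\<U>. closure V \<subseteq> U)"

section \<open>Fixed-point-free patterns\<close>

text \<open>
  Sequences are indexed from 1; the value at index 0 is irrelevant.
\<close>

definition follows_fixed_point_free_pattern :: "(nat \<Rightarrow> 'a set set) \<Rightarrow> bool" where
  "follows_fixed_point_free_pattern \<U> \<longleftrightarrow>
    (\<exists>\<phi> :: nat \<Rightarrow> 'a set \<Rightarrow> 'a set.
      (\<forall>n\<ge>1. \<forall>V\<in>\<U> (n + 1). \<phi> n V \<in> \<U> n) \<and>
      (\<forall>U\<in>\<U> 1. \<forall>V\<in>\<U> 2. U \<inter> V \<noteq> {} \<longrightarrow> \<phi> 1 V \<inter> U = {}) \<and>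
      (\<forall>n\<ge>1. \<forall>U\<in>\<U> (n + 2). \<forall>V\<in>\<U> (n + 1).
         U \<inter> V \<noteq> {} \<longrightarrow> \<phi> (n + 1) U \<inter> \<phi> n V \<noteq> {}) \<and>
      (\<forall>n\<ge>1. \<forall>U\<in>\<U> (n + 1). \<forall>V\<in>\<U> (n + 1).
         U \<inter> V \<noteq> {} \<longrightarrow> \<phi> n U \<inter> \<phi> n V \<noteq> {}))"

definition fixed_point_free_tree_chain_sequence ::
    "(nat \<Rightarrow> 'a::metric_space set set) \<Rightarrow> bool" where
  "fixed_point_free_tree_chain_sequence \<U> \<longleftrightarrow>
    (\<forall>n\<ge>1. tree_chain (\<U> n) \<and> taut (\<U> n)) \<and>
    (\<forall>n\<ge>1. strongly_refines (\<U> (n + 1)) (\<U> n)) \<and>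
    (\<forall>n\<ge>2. mesh (\<U> n) < min_gap (\<U> 1) / 2 ^ n) \<and>
    follows_fixed_point_free_pattern \<U>"

end

theory Submission
  imports Defs "HOL-Library.Transitive_Closure_Table"
begin

text \<open>
  Both directions translate between a map \<open>f\<close> without fixed points on a continuum \<open>X\<close> and
  combinatorial data \<open>\<phi>\<close>, the correspondence being that \<open>\<phi> n V\<close> is a link of chain \<open>n\<close> near \<open>f x\<close> for
  each point \<open>x\<close> of \<open>X\<close> in the link \<open>V\<close> of chain \<open>n + 1\<close>.

  Given a sequence that follows the pattern, choose links around \<open>x\<close> in all chains. The images of
  these links under \<open>\<phi>\<close> shrink and consecutive ones meet, so they converge to a point \<open>f x\<close>. The third
  pattern condition makes \<open>f\<close> continuous. The first one places \<open>x\<close> and the first image link in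
  disjoint members of the first chain, at distance at least \<open>\<rho>\<close>, and the mesh condition keeps \<open>f x\<close>
  within \<open>\<rho> / 2\<close> of that link, so \<open>f\<close> has no fixed point. That \<open>X\<close> is a continuum follows by compactness
  from the nested chains with connected nerves.

  Conversely, let \<open>f\<close> be a map without fixed points on a tree-like continuum. The definition of tree-like
  gives arbitrarily fine covers with trees as nerves, and these can be thickened to taut
  tree-chains in the ambient space without changing their intersection pattern
  (\<open>fine_chain_exists\<close>). By uniform continuity each chain can be chosen fine enough for \<open>f\<close> to
  map the part of \<open>X\<close> near a link into a single link of the previous chain, which defines \<open>\<phi>\<close>.

  What remains is the topology of nerves. Restricting a cover to \<open>X\<close> or shrinking its
  members changes the nerve to a subcomplex, and its realization has to be recognized as a tree again.
  For this purpose trees are characterized by cuts of the vertex set: a finite complex with at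
  least two vertices is realized by a tree if and only if every edge is the only one across some cut and every
  cut that separates vertices is crossed by an edge (\<open>tree_imp_every_edge_bridge\<close>,
  \<open>connected_imp_every_cut_crossed\<close>, \<open>tree_of_bridges\<close>). The first property passes to subcomplexes, and the second
  one holds for the nerve of an open cover of a connected set (\<open>subordinate_cover_nerve_tree\<close>).
\<close>

section \<open>Finite complexes whose geometric realization is a tree\<close>

definition abstract_complex :: "'v set set \<Rightarrow> bool" where
  "abstract_complex K \<longleftrightarrow>
    (\<forall>\<sigma>\<in>K. finite \<sigma> \<and> \<sigma> \<noteq> {} \<and> (\<forall>\<tau>. \<tau> \<subseteq> \<sigma> \<and> \<tau> \<noteq> {} \<longrightarrow> \<tau> \<in> K))"

text \<open>
  Acyclicity and connectedness are both encoded by vertex cuts. In contrast to statements about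
  cycles and walks, a cut restricts to a subcomplex and pulls back along an injective map of vertices,
  and it carries a continuous function on the realization, the mass on one of its sides. A complex
  in which every edge is a bridge has no triangles, so it is automatically a graph.
\<close>

definition every_edge_bridge :: "'v set set \<Rightarrow> bool" where
  "every_edge_bridge K \<longleftrightarrow>
    (\<forall>u v. {u, v} \<in> K \<and> u \<noteq> v \<longrightarrow>
      (\<exists>S. u \<in> S \<and> v \<notin> S \<and> (\<forall>x y. {x, y} \<in> K \<and> x \<in> S \<and> y \<notin> S \<longrightarrow> x = u \<and> y = v)))"

definition every_cut_crossed :: "'v set set \<Rightarrow> bool" where
  "every_cut_crossed K \<longleftrightarrow>
    (\<forall>S a b. {a} \<in> K \<and> a \<in> S \<and> {b} \<in> K \<and> b \<notin> S \<longrightarrow> (\<exists>x y. x \<in> S \<and> y \<notin> S \<and> {x, y} \<in> K))"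

definition vertex_point :: "'v \<Rightarrow> 'v \<Rightarrow> real" where
  "vertex_point u w = (if w = u then 1 else 0)"

definition edge_path :: "'v \<Rightarrow> 'v \<Rightarrow> real \<Rightarrow> 'v \<Rightarrow> real" where
  "edge_path u v s w = (if w = u then 1 - s else if w = v then s else 0)"

lemma face_of_simplex:
  "\<lbrakk>abstract_complex K; \<sigma> \<in> K; \<tau> \<subseteq> \<sigma>; \<tau> \<noteq> {}\<rbrakk> \<Longrightarrow> \<tau> \<in> K"
  unfolding abstract_complex_def by blast

lemma finite_simplex: "\<lbrakk>abstract_complex K; \<sigma> \<in> K\<rbrakk> \<Longrightarrow> finite \<sigma>"
  unfolding abstract_complex_def by (drule(1) bspec) (elim conjE)

lemma nonempty_simplex: "\<lbrakk>abstract_complex K; \<sigma> \<in> K\<rbrakk> \<Longrightarrow> \<sigma> \<noteq> {}"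
  unfolding abstract_complex_def by (drule(1) bspec) (elim conjE)

lemma finite_vertices: "\<lbrakk>abstract_complex K; finite K\<rbrakk> \<Longrightarrow> finite (\<Union>K)"
  by (simp add: finite_simplex)

lemma every_edge_bridgeE:
  assumes "every_edge_bridge K" "{u, v} \<in> K" "u \<noteq> v"
  obtains S where "u \<in> S" "v \<notin> S"
    "\<And>x y. \<lbrakk>{x, y} \<in> K; x \<in> S; y \<notin> S\<rbrakk> \<Longrightarrow> x = u \<and> y = v"
proof -
  have "\<exists>S. u \<in> S \<and> v \<notin> S \<and> (\<forall>x y. {x, y} \<in> K \<and> x \<in> S \<and> y \<notin> S \<longrightarrow> x = u \<and> y = v)"
    using assms(1)[unfolded every_edge_bridge_def, rule_format, of u v] assms(2,3) by simp
  then show thesis using that by blast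
qed

lemma every_cut_crossedD:
  assumes "every_cut_crossed K" "{a} \<in> K" "a \<in> S" "{b} \<in> K" "b \<notin> S"
  shows "\<exists>x y. x \<in> S \<and> y \<notin> S \<and> {x, y} \<in> K"
  using assms(1)[unfolded every_cut_crossed_def, rule_format, of a S b] assms(2-) by simp

lemma edge_path_ends [simp]:
  "pathstart (edge_path u v) = vertex_point u"
  "u \<noteq> v \<Longrightarrow> pathfinish (edge_path u v) = vertex_point v"
  by (auto simp: pathstart_def pathfinish_def edge_path_def vertex_point_def fun_eq_iff)

lemma arc_edge_path:
  assumes "u \<noteq> v" shows "arc (edge_path u v)"
  unfolding arc_def path_def
proof
  show "continuous_on {0..1} (edge_path u v)"
  proof (rule continuous_on_coordinatewise_then_product)
    show "continuous_on {0..1} (\<lambda>s. edge_path u v s w)" for w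
      by (cases "w = u"; cases "w = v") (auto simp: edge_path_def intro!: continuous_intros)
  qed
  show "inj_on (edge_path u v) {0..1}"
    by (rule inj_onI, drule fun_cong[where x = u]) (simp add: edge_path_def)
qed

lemma path_image_edge_path:
  assumes "u \<noteq> v"
  shows "path_image (edge_path u v) =
    {t. (\<forall>w. 0 \<le> t w) \<and> (\<forall>w. w \<notin> {u, v} \<longrightarrow> t w = 0) \<and> t u + t v = 1}" (is "_ = ?R")
proof
  show "path_image (edge_path u v) \<subseteq> ?R"
    using assms by (auto simp: path_image_def edge_path_def)
  show "?R \<subseteq> path_image (edge_path u v)"
  proof
    fix t assume t: "t \<in> ?R"
    then have "t = edge_path u v (t v)"
      by (auto simp: edge_path_def fun_eq_iff)
    moreover have "t v \<in> {0..1}"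
      using t by (smt (verit) atLeastAtMost_iff mem_Collect_eq)
    ultimately show "t \<in> path_image (edge_path u v)"
      unfolding path_image_def by blast
  qed
qed

lemma geometric_realization_sum:
  assumes "t \<in> geometric_realization K" "finite A" "{v. t v \<noteq> 0} \<subseteq> A"
  shows "sum t A = 1"
proof -
  have "sum t {v. t v \<noteq> 0} = sum t A"
    by (rule sum.mono_neutral_left) (use assms in auto)
  then show ?thesis
    using assms(1) by (simp add: geometric_realization_def)
qed

lemma edge_subset_realization:
  assumes K: "abstract_complex K" and uv: "{u, v} \<in> K" "u \<noteq> v"
  shows "path_image (edge_path u v) \<subseteq> geometric_realization K"
proof
  fix t assume "t \<in> path_image (edge_path u v)"
  then have t: "\<forall>w. 0 \<le> t w" "\<forall>w. w \<notin> {u, v} \<longrightarrow> t w = 0" "t u + t v = 1"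
    by (auto simp: path_image_edge_path uv)
  have sub: "{w. t w \<noteq> 0} \<subseteq> {u, v}" using t by blast
  have ne: "{w. t w \<noteq> 0} \<noteq> {}"
    using t(3) by (metis (mono_tags) add_0 empty_Collect_eq zero_neq_one)
  have "sum t {w. t w \<noteq> 0} = sum t {u, v}"
    by (rule sum.mono_neutral_left) (use sub in auto)
  then have "sum t {w. t w \<noteq> 0} = 1" using t uv by simp
  moreover have "{w. t w \<noteq> 0} \<in> K"
    using face_of_simplex[OF K uv(1) sub ne] .
  ultimately show "t \<in> geometric_realization K"
    using t by (simp add: geometric_realization_def)
qed

lemma vertex_point_in_realization:
  "{u} \<in> K \<Longrightarrow> vertex_point u \<in> geometric_realization K"
proof -
  assume "{u} \<in> K"
  moreover have "{v. vertex_point u v \<noteq> 0} = {u}" by (auto simp: vertex_point_def)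
  ultimately show ?thesis
    unfolding geometric_realization_def by (simp add: vertex_point_def)
qed

text \<open>
  The last clause localizes the arc on the edges of the walk; it is what makes the arcs of a cycle
  fit together into a simple closed curve.
\<close>

lemma arc_along_distinct_walk:
  assumes "rtrancl_path r x xs y" "distinct (x # xs)" "xs \<noteq> []"
    and irrefl: "\<And>p q. r p q \<Longrightarrow> p \<noteq> q"
  shows "\<exists>g. arc g \<and> pathstart g = vertex_point x \<and> pathfinish g = vertex_point y \<and>
    (\<forall>t\<in>path_image g. \<exists>p q. r p q \<and> {p, q} \<subseteq> set (x # xs) \<and> t \<in> path_image (edge_path p q))"
  using assms(1-3)
proof (induction rule: rtrancl_path.induct)
  case (base x)
  then show ?case by simp
next
  case (step x y ys z)
  have xy: "x \<noteq> y" using step.hyps irrefl by blast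
  show ?case
  proof (cases "ys = []")
    case True
    then have "z = y" using step.hyps(2) by (auto elim: rtrancl_path.cases)
    have "r x y \<and> {x, y} \<subseteq> set (x # y # ys) \<and> t \<in> path_image (edge_path x y)"
      if "t \<in> path_image (edge_path x y)" for t
      using that step.hyps(1) by simp
    then show ?thesis
      using \<open>z = y\<close> xy arc_edge_path[OF xy]
      by (intro exI[of _ "edge_path x y"]) (simp, blast)
  next
    case False
    have tail: "distinct (y # ys)" using step.prems(1) by simp
    obtain g where g: "arc g" "pathstart g = vertex_point y" "pathfinish g = vertex_point z"
      "\<And>t. t \<in> path_image g \<Longrightarrow> \<exists>p q. r p q \<and> {p, q} \<subseteq> set (y # ys) \<and> t \<in> path_image (edge_path p q)"
      using step.IH[OF tail False] by metis
    \<comment> \<open>The rest of the walk never returns to x, so the coordinate at x vanishes on its arc.\<close>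
    have zero: "t x = 0" if t: "t \<in> path_image g" for t
    proof -
      obtain p q where pq: "r p q" "{p, q} \<subseteq> set (y # ys)" "t \<in> path_image (edge_path p q)"
        using g(4)[OF t] by metis
      then have "x \<notin> {p, q}" using step.prems(1) by auto
      then show ?thesis using pq(3) by (simp add: path_image_edge_path[OF irrefl[OF pq(1)]])
    qed
    have "t = vertex_point y" if t: "t \<in> path_image (edge_path x y)" "t \<in> path_image g" for t
    proof
      fix w
      have "t y = 1" "\<And>w. w \<notin> {x, y} \<Longrightarrow> t w = 0"
        using t(1) zero[OF t(2)] unfolding path_image_edge_path[OF xy] by auto
      then show "t w = vertex_point y w"
        using zero[OF t(2)] by (cases "w = x"; cases "w = y") (auto simp: vertex_point_def)
    qed
    then have "path_image (edge_path x y) \<inter> path_image g \<subseteq> {vertex_point y}" by blast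
    then have "arc (edge_path x y +++ g)"
      using g arc_edge_path[OF xy] xy by (intro arc_join) auto
    moreover have "path_image (edge_path x y +++ g) = path_image (edge_path x y) \<union> path_image g"
      using g xy by (intro path_image_join) auto
    moreover have "\<exists>p q. r p q \<and> {p, q} \<subseteq> set (x # y # ys) \<and> t \<in> path_image (edge_path p q)"
      if "t \<in> path_image (edge_path x y) \<union> path_image g" for t
    proof (cases "t \<in> path_image g")
      case True
      then show ?thesis using g(4)[of t] by (meson insert_subset list.set_intros(2) order_trans set_subset_Cons)
    next
      case False
      then have "r x y \<and> {x, y} \<subseteq> set (x # y # ys) \<and> t \<in> path_image (edge_path x y)"
        using that step.hyps(1) by simp
      then show ?thesis by blast
    qed
    ultimately show ?thesis
      using g by (intro exI[of _ "edge_path x y +++ g"]) (simp add: pathstart_join pathfinish_join)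
  qed
qed

text \<open>
  Delete an edge and let \<open>S\<close> be the set of vertices still reachable from one of its ends. If the
  other end is in \<open>S\<close>, a walk without repetitions between the ends, closed up by the deleted edge, is a
  simple closed curve. Otherwise \<open>S\<close> is the required cut.
\<close>

lemma tree_imp_every_edge_bridge:
  assumes K: "abstract_complex K" and tree: "is_tree (geometric_realization K)"
  shows "every_edge_bridge K"
  unfolding every_edge_bridge_def
proof (intro allI impI)
  fix u v assume uv: "{u, v} \<in> K \<and> u \<noteq> v"
  define r where "r p q \<longleftrightarrow> {p, q} \<in> K \<and> p \<noteq> q \<and> {p, q} \<noteq> {u, v}" for p q
  define S where "S = {w. r\<^sup>*\<^sup>* u w}"
  have "v \<notin> S"
  proof
    assume "v \<in> S"
    then obtain xs where xs: "rtrancl_path r u xs v" "distinct (u # xs)"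
      unfolding S_def by (metis mem_Collect_eq rtrancl_path_distinct rtranclp_eq_rtrancl_path)
    have "xs \<noteq> []" using xs(1) uv by (auto elim: rtrancl_path.cases)
    have rne: "\<And>p q. r p q \<Longrightarrow> p \<noteq> q" unfolding r_def by blast
    obtain g where g: "arc g" "pathstart g = vertex_point u" "pathfinish g = vertex_point v"
      "\<And>t. t \<in> path_image g \<Longrightarrow> \<exists>p q. r p q \<and> t \<in> path_image (edge_path p q)"
      using arc_along_distinct_walk[OF xs \<open>xs \<noteq> []\<close> rne] by metis
    have vu: "v \<noteq> u" using uv by auto
    have "path_image g \<inter> path_image (edge_path v u) \<subseteq> {vertex_point u, vertex_point v}"
    proof
      fix t assume t: "t \<in> path_image g \<inter> path_image (edge_path v u)"
      then obtain p q where pq: "r p q" "t \<in> path_image (edge_path p q)"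
        using g(4)[of t] by blast
      then have tpq: "\<And>w. w \<notin> {p, q} \<Longrightarrow> t w = 0"
        by (simp add: path_image_edge_path[OF rne[OF pq(1)]])
      have tuv: "\<And>w. w \<notin> {v, u} \<Longrightarrow> t w = 0" "t v + t u = 1"
        using t by (simp_all add: path_image_edge_path[OF vu])
      have "\<not> {u, v} \<subseteq> {p, q}" using pq(1) vu unfolding r_def by auto
      then have "t u = 0 \<or> t v = 0" using tpq by blast
      then have "t = vertex_point v \<or> t = vertex_point u"
      proof
        assume "t u = 0"
        then have "t = vertex_point v"
          using tuv vu by (intro ext) (metis add.right_neutral insertE singletonD vertex_point_def)
        then show ?thesis ..
      next
        assume "t v = 0"
        then have "t = vertex_point u"
          using tuv vu by (intro ext) (metis add_0 insertE singletonD vertex_point_def)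
        then show ?thesis ..
      qed
      then show "t \<in> {vertex_point u, vertex_point v}" by blast
    qed
    then have "simple_path (g +++ edge_path v u)"
      using g arc_edge_path[OF vu] vu by (intro simple_path_join_loop) auto
    moreover have "pathfinish (g +++ edge_path v u) = pathstart (g +++ edge_path v u)"
      using g vu by simp
    moreover have "path_image (g +++ edge_path v u) \<subseteq> geometric_realization K"
    proof -
      have "path_image g \<subseteq> geometric_realization K"
        using g(4) edge_subset_realization[OF K] unfolding r_def by blast
      moreover have "path_image (edge_path v u) \<subseteq> geometric_realization K"
        using edge_subset_realization[OF K, of v u] uv by (auto simp: insert_commute)
      ultimately show ?thesis
        using path_image_join_subset by blast
    qed
    ultimately show False using tree unfolding is_tree_def by blast
  qed
  moreover have "x = u \<and> y = v" if xy: "{x, y} \<in> K" "x \<in> S" "y \<notin> S" for x y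
  proof -
    have "\<not> r x y" using xy unfolding S_def by (auto intro: rtranclp.rtrancl_into_rtrancl)
    then have "{x, y} = {u, v}" using xy unfolding r_def by auto
    then show ?thesis using \<open>v \<notin> S\<close> xy by (auto simp: doubleton_eq_iff)
  qed
  ultimately show "\<exists>S. u \<in> S \<and> v \<notin> S \<and> (\<forall>x y. {x, y} \<in> K \<and> x \<in> S \<and> y \<notin> S \<longrightarrow> x = u \<and> y = v)"
    by (intro exI[of _ S]) (auto simp: S_def)
qed

lemma continuous_on_sum_coordinates:
  "continuous_on A (\<lambda>t :: 'v \<Rightarrow> real. sum t S)"
  by (intro continuous_on_sum continuous_on_subset[OF continuous_on_product_coordinates]) auto

text \<open>
  The coordinate mass on a vertex set \<open>S\<close> is the function that detects cuts: it is \<open>1\<close> on simplices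
  inside \<open>S\<close> and \<open>0\<close> on simplices that miss \<open>S\<close>, so a value strictly in between can occur only on a
  simplex that crosses the cut. Intersecting with \<open>\<Union>K\<close> keeps the sum finite.
\<close>

lemma fractional_mass_crosses_cut:
  assumes K: "abstract_complex K" "finite K" and t: "t \<in> geometric_realization K"
    and mass: "0 < sum t (S \<inter> \<Union>K)" "sum t (S \<inter> \<Union>K) < 1"
  shows "\<exists>x y. t x \<noteq> 0 \<and> t y \<noteq> 0 \<and> x \<in> S \<and> y \<notin> S \<and> {x, y} \<in> K"
proof -
  let ?\<sigma> = "{v. t v \<noteq> 0}"
  have \<sigma>: "?\<sigma> \<in> K" using t by (simp add: geometric_realization_def)
  have "\<exists>x\<in>?\<sigma>. x \<in> S"
  proof (rule ccontr)
    assume "\<not> (\<exists>x\<in>?\<sigma>. x \<in> S)"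
    then have "sum t (S \<inter> \<Union>K) = 0" by (intro sum.neutral) auto
    then show False using mass by simp
  qed
  moreover have "\<exists>y\<in>?\<sigma>. y \<notin> S"
  proof (rule ccontr)
    assume "\<not> (\<exists>y\<in>?\<sigma>. y \<notin> S)"
    then have "?\<sigma> \<subseteq> S \<inter> \<Union>K" using \<sigma> by blast
    then have "sum t (S \<inter> \<Union>K) = 1"
      using geometric_realization_sum t finite_vertices[OF K] by blast
    then show False using mass by simp
  qed
  ultimately obtain x y where xy: "x \<in> ?\<sigma>" "y \<in> ?\<sigma>" "x \<in> S" "y \<notin> S" by blast
  then have "{x, y} \<subseteq> ?\<sigma>" "{x, y} \<noteq> {}" by auto
  then have "{x, y} \<in> K" by (rule face_of_simplex[OF K(1) \<sigma>])
  then show ?thesis using xy by blast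
qed

text \<open>
  If no edge crossed a cut, the mass on one side would be a continuous map of the realization
  onto \<open>{0, 1}\<close>.
\<close>

lemma connected_imp_every_cut_crossed:
  assumes K: "abstract_complex K" "finite K" and conn: "connected (geometric_realization K)"
  shows "every_cut_crossed K"
  unfolding every_cut_crossed_def
proof (intro allI impI)
  fix S a b assume ab: "{a} \<in> K \<and> a \<in> S \<and> {b} \<in> K \<and> b \<notin> S"
  define f where "f t = sum t (S \<inter> \<Union>K)" for t :: "'a \<Rightarrow> real"
  have conn_f: "connected (f ` geometric_realization K)"
    using conn continuous_on_sum_coordinates unfolding f_def by (rule connected_continuous_image[rotated])
  have "f (vertex_point a) = 1" "f (vertex_point b) = 0"
    using ab finite_vertices[OF K] by (auto simp: f_def vertex_point_def)
  then have "0 \<in> f ` geometric_realization K" "1 \<in> f ` geometric_realization K"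
    using vertex_point_in_realization ab by (metis image_eqI)+
  then have "1/2 \<in> f ` geometric_realization K"
    by (rule connectedD_interval[OF conn_f]) simp_all
  then obtain t where t: "t \<in> geometric_realization K" "f t = 1/2" by force
  then have "\<exists>x y. t x \<noteq> 0 \<and> t y \<noteq> 0 \<and> x \<in> S \<and> y \<notin> S \<and> {x, y} \<in> K"
    unfolding f_def by (intro fractional_mass_crosses_cut[OF K]) simp_all
  then show "\<exists>x y. x \<in> S \<and> y \<notin> S \<and> {x, y} \<in> K" by blast
qed

text \<open>
  A cut that separates two vertices of a triangle is crossed by two of its edges, so no simplex has
  three vertices.
\<close>

lemma bridge_complex_is_graph:
  assumes K: "abstract_complex K" and br: "every_edge_bridge K" and \<sigma>: "\<sigma> \<in> K"
  shows "(\<exists>u. \<sigma> = {u}) \<or> (\<exists>u v. \<sigma> = {u, v} \<and> u \<noteq> v)"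
proof -
  have fin: "\<sigma> \<noteq> {}" using nonempty_simplex[OF K \<sigma>] .
  have False if abc: "a \<in> \<sigma>" "b \<in> \<sigma>" "c \<in> \<sigma>" "a \<noteq> b" "a \<noteq> c" "b \<noteq> c" for a b c
  proof -
    have e: "{a, c} \<in> K" "{a, b} \<in> K" "{b, c} \<in> K"
      by (rule face_of_simplex[OF K \<sigma>]; use abc in simp)+
    obtain S where "a \<in> S" "c \<notin> S" "\<And>x y. \<lbrakk>{x, y} \<in> K; x \<in> S; y \<notin> S\<rbrakk> \<Longrightarrow> x = a \<and> y = c"
      by (rule every_edge_bridgeE[OF br e(1) abc(5)]) (rule that)
    note S = this
    show False
    proof (cases "b \<in> S")
      case True
      then show False using S(2,3) e(3) abc(4) by blast
    next
      case False
      then show False using S(1,3) e(2) abc(6) by blast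
    qed
  qed
  note three = this
  obtain u where u: "u \<in> \<sigma>" using fin by blast
  show ?thesis
  proof (cases "\<sigma> = {u}")
    case True
    then show ?thesis by blast
  next
    case False
    then obtain v where v: "v \<in> \<sigma>" "v \<noteq> u" using u by blast
    have "w \<in> {u, v}" if "w \<in> \<sigma>" for w
      using three[OF u v(1) that] v(2) by blast
    then have "\<sigma> = {u, v}" using u v(1) by blast
    then show ?thesis using v(2) by metis
  qed
qed

text \<open>
  The type of all functions on the vertices need not be metrizable, since vertices are arbitrary
  sets. The finitely many coordinates that matter can be listed by natural numbers, and the
  functions on those form a metric space.
\<close>

lemma finite_realization_embeds:
  assumes K: "abstract_complex K" "finite K"
  shows "\<exists>F :: ('v \<Rightarrow> real) \<Rightarrow> (nat \<Rightarrow> real).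
    continuous_on (geometric_realization K) F \<and> inj_on F (geometric_realization K)"
proof -
  have finV: "finite (\<Union>K)" using finite_vertices[OF K] .
  then obtain h where h: "bij_betw h {0..<card (\<Union>K)} (\<Union>K)"
    using ex_bij_betw_nat_finite by blast
  define F :: "('v \<Rightarrow> real) \<Rightarrow> (nat \<Rightarrow> real)" where "F t i = t (h i)" for t i
  have "continuous_on (geometric_realization K) F"
    unfolding F_def
    by (intro continuous_on_coordinatewise_then_product
        continuous_on_subset[OF continuous_on_product_coordinates]) auto
  moreover have "inj_on F (geometric_realization K)"
  proof (rule inj_onI)
    fix s t assume st: "s \<in> geometric_realization K" "t \<in> geometric_realization K" "F s = F t"
    show "s = t"
    proof
      fix v show "s v = t v"
      proof (cases "v \<in> \<Union>K")
        case True
        then obtain i where "v = h i" using h by (metis bij_betw_imp_surj_on imageE)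
        then show ?thesis using fun_cong[OF st(3), of i] by (simp add: F_def)
      next
        case False
        then have "v \<notin> {v. s v \<noteq> 0}" "v \<notin> {v. t v \<noteq> 0}"
          using st(1,2) unfolding geometric_realization_def by blast+
        then show ?thesis by simp
      qed
    qed
  qed
  ultimately show ?thesis by blast
qed

lemma metrizable_compact_realization:
  assumes K: "abstract_complex K" "finite K" and comp: "compact (geometric_realization K)"
  shows "metrizable_space (top_of_set (geometric_realization K))"
proof -
  obtain F :: "('a \<Rightarrow> real) \<Rightarrow> (nat \<Rightarrow> real)" where F: "continuous_on (geometric_realization K) F"
    "inj_on F (geometric_realization K)"
    using finite_realization_embeds[OF K] by blast
  then obtain g where "homeomorphism (geometric_realization K) (F ` geometric_realization K) F g"
    using homeomorphism_compact[OF comp] by blast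
  then have "top_of_set (geometric_realization K) homeomorphic_space top_of_set (F ` geometric_realization K)"
    unfolding homeomorphic_space_def homeomorphic_maps_def homeomorphism_def
    by (intro exI[of _ F] exI[of _ g]) (auto simp: continuous_map_in_subtopology)
  then show ?thesis
    using homeomorphic_metrizable_space metrizable_space_subtopology metrizable_space_euclidean by blast
qed

text \<open>
  The realization is the union of its edges, which are arcs. It contains no simple closed curve for the
  following reason. Such a curve \<open>c\<close> has two points on one edge \<open>{u, v}\<close>. The mass \<open>f\<close> on the side
  of \<open>u\<close> of the cut belonging to this edge is injective on the edge and takes each value strictly
  between \<open>0\<close> and \<open>1\<close> only there, hence exactly once. Removing from \<open>c\<close> the point where a value between
  those at the two given points is taken leaves a connected set, whose image under \<open>f\<close> would have
  to contain the removed value. The hypothesis on two different vertices cannot be dropped because a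
  single point is not a tree here: arcs are nondegenerate.
\<close>

lemma tree_of_bridges:
  assumes K: "abstract_complex K" "finite K" and br: "every_edge_bridge K"
    and cut: "every_cut_crossed K" and ab: "{a} \<in> K" "{b} \<in> K" "a \<noteq> b"
  shows "is_tree (geometric_realization K)"
proof -
  let ?R = "geometric_realization K"
  have finV: "finite (\<Union>K)" using finite_vertices[OF K] .
  have vert: "{v} \<in> K" if "v \<in> \<Union>K" for v
    using that face_of_simplex[OF K(1)] by (metis UnionE empty_subsetI insert_not_empty insert_subset)
  define E where "E = {e \<in> K. \<exists>u v. e = {u, v} \<and> u \<noteq> v}"
  have finE: "finite E" using K unfolding E_def by simp
  have "\<exists>p. \<forall>e\<in>E. e = {fst (p e), snd (p e)} \<and> fst (p e) \<noteq> snd (p e)"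
    unfolding E_def by (intro bchoice) force
  then obtain p where p: "\<And>e. e \<in> E \<Longrightarrow> e = {fst (p e), snd (p e)} \<and> fst (p e) \<noteq> snd (p e)"
    by blast
  define arc_of where "arc_of e = edge_path (fst (p e)) (snd (p e))" for e
  have img: "path_image (arc_of e) = path_image (edge_path u v)"
    if "{u, v} = e" "u \<noteq> v" "e \<in> E" for e u v
    using p[OF that(3)] that unfolding arc_of_def
    by (auto simp: path_image_edge_path doubleton_eq_iff add.commute)
  \<comment> \<open>Crossing the cut around a single vertex gives an edge at it, so vertices lie on edges.\<close>
  have on_edge: "\<exists>v. v \<noteq> u \<and> {u, v} \<in> K" if u: "{u} \<in> K" for u
  proof -
    obtain w where "{w} \<in> K" "w \<noteq> u" using ab by metis
    then obtain x y where "x \<in> {u}" "y \<notin> {u}" "{x, y} \<in> K"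
      using cut u unfolding every_cut_crossed_def by (metis singletonD singletonI)
    then show ?thesis by auto
  qed
  have Rsub: "\<exists>e\<in>E. t \<in> path_image (arc_of e)" if t: "t \<in> ?R" for t
  proof -
    let ?\<sigma> = "{v. t v \<noteq> 0}"
    have \<sigma>: "?\<sigma> \<in> K" using t by (simp add: geometric_realization_def)
    have "\<exists>u v. u \<noteq> v \<and> {u, v} \<in> K \<and> ?\<sigma> \<subseteq> {u, v}"
      using bridge_complex_is_graph[OF K(1) br \<sigma>]
    proof (elim disjE exE conjE)
      fix u assume u: "?\<sigma> = {u}"
      then have "{u} \<in> K" using \<sigma> by simp
      from on_edge[OF this] obtain v where v: "v \<noteq> u" "{u, v} \<in> K" by (elim exE conjE) (rule that)
      have "u \<noteq> v \<and> {u, v} \<in> K \<and> ?\<sigma> \<subseteq> {u, v}"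
        unfolding u using v by simp
      then show ?thesis by (intro exI)
    next
      fix u v assume uv: "?\<sigma> = {u, v}" "u \<noteq> v"
      then have "{u, v} \<in> K" using \<sigma> by simp
      then have "u \<noteq> v \<and> {u, v} \<in> K \<and> ?\<sigma> \<subseteq> {u, v}"
        unfolding uv(1) using uv(2) by simp
      then show ?thesis by (intro exI)
    qed
    then obtain u v where uv: "u \<noteq> v" "{u, v} \<in> K" "?\<sigma> \<subseteq> {u, v}" by (elim exE conjE) (rule that)
    have "t u + t v = 1"
      using geometric_realization_sum[OF t _ uv(3)] uv(1) by simp
    then have "t \<in> path_image (edge_path u v)"
      using t uv unfolding path_image_edge_path[OF uv(1)] geometric_realization_def by auto
    moreover have "{u, v} \<in> E" using uv unfolding E_def by blast
    ultimately show ?thesis using img uv(1) by blast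
  qed
  have Rsup: "path_image (arc_of e) \<subseteq> ?R" if "e \<in> E" for e
    using edge_subset_realization[OF K(1)] p[OF that] that unfolding arc_of_def E_def by auto
  have R_eq: "?R = (\<Union>e\<in>E. path_image (arc_of e))"
    using Rsub Rsup by blast
  have arcs: "arc (arc_of e)" if "e \<in> E" for e
    unfolding arc_of_def using p[OF that] by (blast intro: arc_edge_path)
  have compact: "compact ?R"
    unfolding R_eq using finE arcs by (intro compact_UN) (auto intro: compact_arc_image)
  have connected: "connected ?R"
  proof -
    \<comment> \<open>The vertices in the component of a form a side of a cut that no edge crosses.\<close>
    let ?C = "connected_component_set ?R (vertex_point a)"
    have aC: "vertex_point a \<in> ?C"
      using vertex_point_in_realization[OF ab(1)] by simp
    have sub: "path_image (arc_of e) \<subseteq> ?C" if e: "e \<in> E" and u: "u \<in> e" "vertex_point u \<in> ?C" for e u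
    proof -
      have "vertex_point u \<in> path_image (arc_of e)"
        using p[OF e] u unfolding arc_of_def
        by (metis edge_path_ends insertE pathfinish_in_path_image pathstart_in_path_image singletonD)
      then show ?thesis
        by (metis Rsup[OF e] arcs[OF e] u(2) connected_component_eq connected_component_maximal
            connected_arc_image)
    qed
    have allV: "vertex_point v \<in> ?C" if v: "{v} \<in> K" for v
    proof (rule ccontr)
      assume "vertex_point v \<notin> ?C"
      then have "\<exists>x y. x \<in> {w. vertex_point w \<in> ?C} \<and> y \<notin> {w. vertex_point w \<in> ?C} \<and> {x, y} \<in> K"
        using aC by (intro every_cut_crossedD[OF cut ab(1) _ v]) auto
      then obtain x y where xy: "vertex_point x \<in> ?C" "vertex_point y \<notin> ?C" "{x, y} \<in> K"
        by (elim exE conjE) (rule that, auto)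
      then have "x \<noteq> y" by auto
      then have e: "{x, y} \<in> E" using xy unfolding E_def by blast
      have "vertex_point y \<in> path_image (arc_of {x, y})"
        unfolding img[OF refl \<open>x \<noteq> y\<close> e] using \<open>x \<noteq> y\<close>
        by (metis edge_path_ends(2) pathfinish_in_path_image)
      then show False using sub[OF e, of x] xy by blast
    qed
    have "?R \<subseteq> ?C"
    proof
      fix t assume "t \<in> ?R"
      then obtain e where e: "e \<in> E" "t \<in> path_image (arc_of e)" using Rsub by blast
      have "fst (p e) \<in> e" using p[OF e(1)] by blast
      moreover have "{fst (p e)} \<in> K"
        using e(1) \<open>fst (p e) \<in> e\<close> vert unfolding E_def by blast
      ultimately show "t \<in> ?C" using sub[OF e(1)] allV e(2) by blast
    qed
    then have "?R = ?C" using connected_component_subset by blast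
    then show ?thesis by (metis connected_connected_component)
  qed
  have meet: "path_image (arc_of d) \<inter> path_image (arc_of e) \<subseteq>
      {pathstart (arc_of d), pathfinish (arc_of d)} \<inter> {pathstart (arc_of e), pathfinish (arc_of e)}"
    if de: "d \<in> E" "e \<in> E" "d \<noteq> e" for d e
  proof
    fix t assume t: "t \<in> path_image (arc_of d) \<inter> path_image (arc_of e)"
    have ends: "{pathstart (arc_of c), pathfinish (arc_of c)} = vertex_point ` c" if "c \<in> E" for c
      unfolding arc_of_def using p[OF that] by (metis edge_path_ends image_empty image_insert)
    define q w where "q = fst (p d)" and "w = snd (p d)"
    have d: "d = {q, w}" "q \<noteq> w" using p[OF de(1)] unfolding q_def w_def by auto
    have fe: "fst (p e) \<noteq> snd (p e)" and e: "e = {fst (p e), snd (p e)}" using p[OF de(2)] by auto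
    have td: "\<And>x. x \<notin> d \<Longrightarrow> t x = 0" "t q + t w = 1"
      using t img[of q w d] d de(1) by (auto simp: path_image_edge_path[OF d(2)])
    have te: "\<And>x. x \<notin> e \<Longrightarrow> t x = 0"
      using t e unfolding arc_of_def path_image_edge_path[OF fe] by blast
    \<comment> \<open>Two different edges share at most one end, and a common point of their arcs is supported there.\<close>
    have "\<not> d \<subseteq> e"
    proof
      assume "d \<subseteq> e"
      moreover have "card d = 2" "card e = 2"
        using d e fe by (simp, metis card_2_iff)
      ultimately show False using de(3) by (metis card_subset_eq card.infinite zero_neq_numeral)
    qed
    then have "q \<notin> e \<or> w \<notin> e" using d by blast
    then obtain y where y: "y \<in> d" "y \<in> e" "t y = 1" "\<And>x. x \<noteq> y \<Longrightarrow> t x = 0"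
    proof
      assume "q \<notin> e"
      then have "t q = 0" using te by blast
      then have "t w = 1" "\<And>x. x \<noteq> w \<Longrightarrow> t x = 0" using td d by (simp, metis insertE singletonD)
      then show thesis using that[of w] te d by force
    next
      assume "w \<notin> e"
      then have "t w = 0" using te by blast
      then have "t q = 1" "\<And>x. x \<noteq> q \<Longrightarrow> t x = 0" using td d by (simp, metis insertE singletonD)
      then show thesis using that[of q] te d by force
    qed
    then have "t = vertex_point y" by (auto simp: vertex_point_def fun_eq_iff)
    then show "t \<in> {pathstart (arc_of d), pathfinish (arc_of d)} \<inter> {pathstart (arc_of e), pathfinish (arc_of e)}"
      unfolding ends[OF de(1)] ends[OF de(2)] using y(1,2) by blast
  qed
  have graph: "is_graph ?R"
    unfolding is_graph_def continuum_def
  proof (intro conjI exI[of _ "arc_of ` E"])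
    show "?R \<noteq> {}" using vertex_point_in_realization[OF ab(1)] by (metis empty_iff)
    show "compact ?R" by (rule compact)
    show "connected ?R" by (rule connected)
    show "metrizable_space (top_of_set ?R)" using metrizable_compact_realization[OF K compact] .
    show "?R = (\<Union>g\<in>arc_of ` E. path_image g)" using R_eq by simp
    show "finite (arc_of ` E)" using finE by simp
    show "\<forall>g\<in>arc_of ` E. arc g" using arcs by blast
    show "\<forall>g\<in>arc_of ` E. \<forall>h\<in>arc_of ` E. g \<noteq> h \<longrightarrow>
        path_image g \<inter> path_image h \<subseteq> {pathstart g, pathfinish g} \<inter> {pathstart h, pathfinish h}"
    proof (intro ballI impI)
      fix g h assume gh: "g \<in> arc_of ` E" "h \<in> arc_of ` E" "g \<noteq> h"
      obtain d where d: "d \<in> E" "g = arc_of d" using gh(1) by (rule imageE)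
      obtain e where e: "e \<in> E" "h = arc_of e" using gh(2) by (rule imageE)
      have "d \<noteq> e" using d e gh(3) by metis
      then show "path_image g \<inter> path_image h \<subseteq> {pathstart g, pathfinish g} \<inter> {pathstart h, pathfinish h}"
        unfolding d(2) e(2) by (rule meet[OF d(1) e(1)])
    qed
  qed
  have "False" if c: "simple_path c" "pathfinish c = pathstart c" "path_image c \<subseteq> ?R" for c
  proof -
    let ?C = "path_image c"
    have "infinite (c ` {0<..<1})"
    proof
      assume "finite (c ` {0<..<1})"
      moreover have "inj_on c {0<..<1}"
        using c(1) unfolding simple_path_def loop_free_def inj_on_def by force
      ultimately have "finite {0<..<1::real}" using finite_imageD by blast
      then show False using infinite_Ioo[of 0 "1::real"] by simp
    qed
    then have infC: "infinite ?C"
      unfolding path_image_def by (rule infinite_super[rotated]) (rule image_mono, force)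
    have "\<exists>e\<in>E. infinite (?C \<inter> path_image (arc_of e))"
    proof (rule ccontr)
      assume "\<not> ?thesis"
      then have "finite (\<Union>e\<in>E. ?C \<inter> path_image (arc_of e))" using finE by (intro finite_UN_I) auto
      moreover have "?C \<subseteq> (\<Union>e\<in>E. ?C \<inter> path_image (arc_of e))" using c(3) R_eq by blast
      ultimately show False using infC finite_subset by blast
    qed
    then obtain e where e: "e \<in> E" "infinite (?C \<inter> path_image (arc_of e))" by blast
    define u v where "u = fst (p e)" and "v = snd (p e)"
    have uv: "e = {u, v}" "u \<noteq> v" using p[OF e(1)] unfolding u_def v_def by auto
    have uvK: "{u, v} \<in> K" using uv(1) e(1) unfolding E_def by simp
    obtain S where S: "u \<in> S" "v \<notin> S" "\<And>x y. {x, y} \<in> K \<Longrightarrow> x \<in> S \<Longrightarrow> y \<notin> S \<Longrightarrow> x = u \<and> y = v"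
      by (rule every_edge_bridgeE[OF br uvK uv(2)]) (rule that)
    define f where "f t = sum t (S \<inter> \<Union>K)" for t :: "'a \<Rightarrow> real"
    have contf: "continuous_on A f" for A
      unfolding f_def by (rule continuous_on_sum_coordinates)
    have uK: "u \<in> \<Union>K" using uv e(1) unfolding E_def by blast
    have f_edge: "f t = t u" if "t \<in> path_image (edge_path u v)" for t
    proof -
      have "sum t {u} = f t" unfolding f_def
        by (rule sum.mono_neutral_left) (use finV S uK that in \<open>auto simp: path_image_edge_path[OF uv(2)]\<close>)
      then show ?thesis by simp
    qed
    have cross: "t \<in> path_image (edge_path u v)" if t: "t \<in> ?R" "0 < f t" "f t < 1" for t
    proof -
      let ?\<sigma> = "{v. t v \<noteq> 0}"
      have \<sigma>: "?\<sigma> \<in> K" using t by (simp add: geometric_realization_def)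
      obtain x y where xy: "t x \<noteq> 0" "t y \<noteq> 0" "x \<in> S" "y \<notin> S" "{x, y} \<in> K"
        using fractional_mass_crosses_cut[OF K t(1), of S] t(2,3) unfolding f_def by blast
      then have "u \<in> ?\<sigma>" "v \<in> ?\<sigma>" using S(3)[of x y] by auto
      then have sub: "?\<sigma> = {u, v}"
        using bridge_complex_is_graph[OF K(1) br \<sigma>] uv(2) by (elim disjE exE conjE) auto
      then have "t u + t v = 1" using geometric_realization_sum[OF t(1), of "{u, v}"] uv(2) by simp
      then show ?thesis
        using t(1) sub unfolding path_image_edge_path[OF uv(2)] geometric_realization_def by auto
    qed
    have e_img: "path_image (arc_of e) = path_image (edge_path u v)"
      using img[of u v e] uv e(1) by simp
    \<comment> \<open>On this edge f is one of the two coordinates, so it separates points.\<close>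
    obtain x y where xy: "x \<in> ?C" "y \<in> ?C" "f x < f y"
      "x \<in> path_image (edge_path u v)" "y \<in> path_image (edge_path u v)"
    proof -
      obtain x where x: "x \<in> ?C \<inter> path_image (arc_of e)"
        using infinite_imp_nonempty[OF e(2)] by (metis ex_in_conv)
      have "?C \<inter> path_image (arc_of e) - {x} \<noteq> {}"
        using infinite_imp_nonempty[OF infinite_remove[OF e(2)]] .
      then obtain y where y: "y \<in> ?C \<inter> path_image (arc_of e)" "y \<noteq> x" by blast
      have "f x \<noteq> f y"
      proof
        assume "f x = f y"
        then have "x u = y u" using f_edge x y unfolding e_img by auto
        moreover have "x v = y v" "\<And>w. w \<notin> {u, v} \<Longrightarrow> x w = y w"
          using x y \<open>x u = y u\<close> unfolding e_img path_image_edge_path[OF uv(2)] by auto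
        ultimately have "x = y" by (metis empty_iff ext insertE)
        then show False using y by simp
      qed
      then show thesis using that x y unfolding e_img by (metis Int_iff linorder_less_linear)
    qed
    define s where "s = (f x + f y) / 2"
    have s: "f x < s" "s < f y" using xy(3) by (auto simp: s_def)
    have "0 \<le> f x" "f y \<le> 1"
      using f_edge xy(4,5) unfolding path_image_edge_path[OF uv(2)] by (auto, smt (verit))
    then have s01: "0 < s" "s < 1" using s by auto
    have conC: "connected ?C" using c(1) by (simp add: connected_simple_path_image)
    have "s \<in> f ` ?C"
      using connected_continuous_image[OF contf conC] xy s
      by (meson connectedD_interval imageI less_imp_le)
    then obtain z where z: "z \<in> ?C" "f z = s" by blast
    obtain a where a: "a \<in> {0..1}" "c a = z" using z(1) unfolding path_image_def by blast
    have "connected (?C - {z})"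
    proof -
      let ?c = "shiftpath a c"
      have "simple_path ?c" using simple_path_shiftpath c a by auto
      moreover have "path_image ?c = ?C" "pathstart ?c = z" "pathfinish ?c = z"
        using a c path_image_shiftpath pathstart_shiftpath pathfinish_shiftpath by auto
      ultimately show ?thesis using connected_simple_path_endless by fastforce
    qed
    then have "connected (f ` (?C - {z}))" by (rule connected_continuous_image[OF contf])
    moreover have "f x \<in> f ` (?C - {z})" "f y \<in> f ` (?C - {z})" using xy z s by auto
    ultimately have "s \<in> f ` (?C - {z})" using s by (meson connectedD_interval less_imp_le)
    then obtain w where w: "w \<in> ?C" "w \<noteq> z" "f w = s" by blast
    have we: "w \<in> path_image (edge_path u v)" "z \<in> path_image (edge_path u v)"
      using cross c(3) w z s01 by auto
    then have "w u = z u" using f_edge w z by simp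
    then have "w v = z v" "\<And>x. x \<notin> {u, v} \<Longrightarrow> w x = z x"
      using we unfolding path_image_edge_path[OF uv(2)] by auto
    then have "w = z" using \<open>w u = z u\<close> by (metis empty_iff ext insertE)
    then show False using w by simp
  qed
  then show ?thesis using graph unfolding is_tree_def by blast
qed

section \<open>Nerves of covers of connected sets\<close>

lemma abstract_complex_nerve: "abstract_complex (nerve \<U>)"
  unfolding abstract_complex_def
proof (intro ballI conjI allI impI)
  fix \<sigma> assume \<sigma>: "\<sigma> \<in> nerve \<U>"
  then show "finite \<sigma>" "\<sigma> \<noteq> {}" by (simp_all add: nerve_def)
  fix \<tau> assume \<tau>: "\<tau> \<subseteq> \<sigma> \<and> \<tau> \<noteq> {}"
  have "\<Inter>\<sigma> \<subseteq> \<Inter>\<tau>" using \<tau> by blast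
  then show "\<tau> \<in> nerve \<U>"
    using \<sigma> \<tau> finite_subset[of \<tau> \<sigma>] by (auto simp: nerve_def)
qed

lemma finite_nerve: "finite \<U> \<Longrightarrow> finite (nerve \<U>)"
  by (rule finite_subset[of _ "Pow \<U>"]) (auto simp: nerve_def)

lemma singleton_in_nerve: "{V} \<in> nerve \<U> \<longleftrightarrow> V \<in> \<U> \<and> V \<noteq> {}"
  by (simp add: nerve_def)

lemma pair_in_nerve: "{V, W} \<in> nerve \<U> \<longleftrightarrow> V \<in> \<U> \<and> W \<in> \<U> \<and> V \<inter> W \<noteq> {}"
  by (simp add: nerve_def)

text \<open>
  The two sides of an uncrossed cut would have disjoint unions and so separate \<open>X\<close>.
  The members of the family may be subsets of \<open>X\<close> or open sets of the ambient space; in the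
  latter case they have to meet \<open>X\<close>.
\<close>

lemma connected_cover_every_cut_crossed:
  assumes conn: "connected X" and cover: "X \<subseteq> \<Union>\<G>"
    and op: "\<And>G. G \<in> \<G> \<Longrightarrow> openin (top_of_set X) (G \<inter> X)"
    and meets: "\<And>G. \<lbrakk>G \<in> \<G>; G \<noteq> {}\<rbrakk> \<Longrightarrow> G \<inter> X \<noteq> {}"
  shows "every_cut_crossed (nerve \<G>)"
  unfolding every_cut_crossed_def
proof (intro allI impI, rule ccontr)
  fix S a b
  assume ab: "{a} \<in> nerve \<G> \<and> a \<in> S \<and> {b} \<in> nerve \<G> \<and> b \<notin> S"
    and no: "\<not> (\<exists>x y. x \<in> S \<and> y \<notin> S \<and> {x, y} \<in> nerve \<G>)"
  define A B where "A = (\<Union>G\<in>\<G> \<inter> S. G \<inter> X)" and "B = (\<Union>G\<in>\<G> - S. G \<inter> X)"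
  have "openin (top_of_set X) A" "openin (top_of_set X) B"
    unfolding A_def B_def by (rule openin_Union, use op in blast)+
  moreover have "X \<subseteq> A \<union> B" using cover unfolding A_def B_def by blast
  moreover have "A \<inter> B = {}"
    using no unfolding A_def B_def pair_in_nerve by blast
  moreover have "A \<noteq> {}" "B \<noteq> {}"
    using ab meets[of a] meets[of b] unfolding A_def B_def singleton_in_nerve by blast+
  ultimately show False using conn unfolding connected_openin by blast
qed

text \<open>
  This is how tree nerves are inherited by a cover that is obtained from another one by shrinking its
  members and then modifying them. The injection \<open>h\<close> carries the edges of the nerve of \<open>\<G>\<close> to edges
  of the nerve of \<open>\<V>\<close>, so cuts pull back and every edge stays a bridge. Connectedness does not pass
  to subgraphs; it comes from the connectedness of \<open>X\<close> instead. Since no member contains \<open>X\<close>, the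
  nerve has two different vertices.
\<close>

lemma subordinate_cover_nerve_tree:
  assumes fin: "finite \<G>" and bridge: "every_edge_bridge (nerve \<V>)"
    and conn: "connected X" and ne: "X \<noteq> {}" and cover: "X \<subseteq> \<Union>\<G>"
    and op: "\<And>G. G \<in> \<G> \<Longrightarrow> openin (top_of_set X) (G \<inter> X)"
    and meets: "\<And>G. \<lbrakk>G \<in> \<G>; G \<noteq> {}\<rbrakk> \<Longrightarrow> G \<inter> X \<noteq> {}"
    and proper: "\<And>G. G \<in> \<G> \<Longrightarrow> \<not> X \<subseteq> G"
    and inj: "inj_on h \<G>" and hV: "\<And>G. G \<in> \<G> \<Longrightarrow> h G \<in> \<V>"
    and hom: "\<And>G H. \<lbrakk>G \<in> \<G>; H \<in> \<G>; G \<inter> H \<noteq> {}\<rbrakk> \<Longrightarrow> h G \<inter> h H \<noteq> {}"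
  shows "is_tree (geometric_realization (nerve \<G>))"
proof -
  obtain x where x: "x \<in> X" using ne by blast
  obtain G where G: "G \<in> \<G>" "x \<in> G" using cover x by blast
  obtain y where y: "y \<in> X" "y \<notin> G" using proper[OF G(1)] by blast
  obtain H where H: "H \<in> \<G>" "y \<in> H" using cover y(1) by blast
  have GH: "{G} \<in> nerve \<G>" "{H} \<in> nerve \<G>" "G \<noteq> H"
    using G H y unfolding singleton_in_nerve by blast+
  have "every_edge_bridge (nerve \<G>)"
    unfolding every_edge_bridge_def
  proof (intro allI impI)
    fix P Q assume PQ: "{P, Q} \<in> nerve \<G> \<and> P \<noteq> Q"
    then have PQ': "P \<in> \<G>" "Q \<in> \<G>" "P \<inter> Q \<noteq> {}" "P \<noteq> Q" unfolding pair_in_nerve by auto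
    have e: "{h P, h Q} \<in> nerve \<V>" "h P \<noteq> h Q"
      unfolding pair_in_nerve using PQ' hV hom inj by (auto dest: inj_onD)
    obtain S where S: "h P \<in> S" "h Q \<notin> S"
      "\<And>x y. \<lbrakk>{x, y} \<in> nerve \<V>; x \<in> S; y \<notin> S\<rbrakk> \<Longrightarrow> x = h P \<and> y = h Q"
      by (rule every_edge_bridgeE[OF bridge e]) (rule that)
    have "M = P \<and> N = Q" if MN: "{M, N} \<in> nerve \<G>" "h M \<in> S" "h N \<notin> S" for M N
    proof -
      have MN': "M \<in> \<G>" "N \<in> \<G>" "M \<inter> N \<noteq> {}" using MN(1) unfolding pair_in_nerve by auto
      then have "h M = h P \<and> h N = h Q"
        using S(3)[of "h M" "h N"] MN(2,3) hV hom unfolding pair_in_nerve by simp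
      then show ?thesis using inj MN' PQ' by (auto dest: inj_onD)
    qed
    then show "\<exists>S. P \<in> S \<and> Q \<notin> S \<and> (\<forall>x y. {x, y} \<in> nerve \<G> \<and> x \<in> S \<and> y \<notin> S \<longrightarrow> x = P \<and> y = Q)"
      using S(1,2) by (intro exI[of _ "{W. h W \<in> S}"]) auto
  qed
  then show ?thesis
    using tree_of_bridges[OF abstract_complex_nerve finite_nerve[OF fin] _
        connected_cover_every_cut_crossed[OF conn cover op meets] GH] by blast
qed

lemma tree_chain_nerve:
  assumes "tree_chain \<U>"
  shows "every_edge_bridge (nerve \<U>)" "every_cut_crossed (nerve \<U>)" "\<exists>U\<in>\<U>. U \<noteq> {}"
proof -
  have tree: "is_tree (geometric_realization (nerve \<U>))" and fin: "finite \<U>"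
    using assms unfolding tree_chain_def by auto
  show "every_edge_bridge (nerve \<U>)"
    by (rule tree_imp_every_edge_bridge[OF abstract_complex_nerve tree])
  have "connected (geometric_realization (nerve \<U>))"
    using tree unfolding is_tree_def is_graph_def continuum_def by blast
  then show "every_cut_crossed (nerve \<U>)"
    by (rule connected_imp_every_cut_crossed[OF abstract_complex_nerve finite_nerve[OF fin]])
  have "geometric_realization (nerve \<U>) \<noteq> {}"
    using tree unfolding is_tree_def is_graph_def continuum_def by blast
  then obtain t where "t \<in> geometric_realization (nerve \<U>)" by blast
  then have "{v. t v \<noteq> 0} \<in> nerve \<U>" by (simp add: geometric_realization_def)
  then obtain \<sigma> where "\<sigma> \<subseteq> \<U>" "\<sigma> \<noteq> {}" "\<Inter>\<sigma> \<noteq> {}" unfolding nerve_def by blast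
  then show "\<exists>U\<in>\<U>. U \<noteq> {}" by blast
qed

section \<open>A pattern sequence gives a tree-like continuum and a map without fixed points\<close>

lemma convergent_of_halving_steps:
  fixes z :: "nat \<Rightarrow> 'a::complete_space"
  assumes step: "\<And>n. n \<ge> N \<Longrightarrow> dist (z n) (z (Suc n)) \<le> c / 2 ^ Suc n"
  obtains l where "z \<longlonglongrightarrow> l" "\<And>n. n \<ge> N \<Longrightarrow> dist (z n) l \<le> c / 2 ^ n"
proof -
  have c: "0 \<le> c" using step[of N] zero_le_dist[of "z N" "z (Suc N)"]
    by (smt (verit) divide_less_0_iff order_refl zero_less_power)
  have tail: "dist (z n) (z (n + k)) \<le> c / 2 ^ n - c / 2 ^ (n + k)" if "n \<ge> N" for n k
  proof (induction k)
    case 0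
    then show ?case by simp
  next
    case (Suc k)
    have "dist (z n) (z (n + Suc k)) \<le> dist (z n) (z (n + k)) + dist (z (n + k)) (z (Suc (n + k)))"
      using dist_triangle by simp
    also have "\<dots> \<le> (c / 2 ^ n - c / 2 ^ (n + k)) + c / 2 ^ Suc (n + k)"
      using Suc.IH step[of "n + k"] that by linarith
    also have "\<dots> = c / 2 ^ n - c / 2 ^ (n + Suc k)"
      by (simp add: field_simps)
    finally show ?case .
  qed
  have near: "dist (z n) (z m) \<le> c / 2 ^ n" if "n \<ge> N" "m \<ge> n" for n m
    using tail[OF that(1), of "m - n"] that(2) c by (smt (verit) divide_nonneg_pos le_add_diff_inverse zero_less_power)
  have small: "(\<lambda>n. c / 2 ^ n) \<longlonglongrightarrow> 0"
    using LIMSEQ_divide_realpow_zero[of 2 c] by simp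
  have "Cauchy z"
  proof (rule metric_CauchyI)
    fix e :: real assume "e > 0"
    then have "\<forall>\<^sub>F n in sequentially. c / 2 ^ n < e / 2"
      using small by (intro order_tendstoD(2)) auto
    then obtain M where M: "\<And>n. n \<ge> M \<Longrightarrow> c / 2 ^ n < e / 2" unfolding eventually_sequentially by blast
    let ?M = "max M N"
    have "dist (z m) (z n) < e" if "m \<ge> ?M" "n \<ge> ?M" for m n
    proof -
      have "dist (z ?M) (z m) \<le> c / 2 ^ ?M" "dist (z ?M) (z n) \<le> c / 2 ^ ?M" "c / 2 ^ ?M < e / 2"
        using near[of ?M m] near[of ?M n] M[of ?M] that by simp_all
      then show ?thesis using dist_triangle3[of "z m" "z n" "z ?M"] by linarith
    qed
    then show "\<exists>M. \<forall>m\<ge>M. \<forall>n\<ge>M. dist (z m) (z n) < e" by blast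
  qed
  then obtain l where l: "z \<longlonglongrightarrow> l" using convergent_eq_Cauchy by blast
  have "dist (z n) l \<le> c / 2 ^ n" if "n \<ge> N" for n
  proof (rule tendsto_upperbound)
    show "(\<lambda>m. dist (z n) (z m)) \<longlonglongrightarrow> dist (z n) l" using l by (intro tendsto_intros)
    show "\<forall>\<^sub>F m in sequentially. dist (z n) (z m) \<le> c / 2 ^ n"
      using near[OF that] unfolding eventually_sequentially by blast
  qed simp
  with l show thesis by (rule that)
qed

text \<open>
  With the extended real \<open>min_gap\<close> replaced by a positive real \<open>\<rho>\<close> and the mesh by distances of points,
  all estimates for the limit map take place in the reals.
\<close>

locale pattern_sequence =
  fixes \<U> :: "nat \<Rightarrow> 'a::heine_borel set set" and \<phi> :: "nat \<Rightarrow> 'a set \<Rightarrow> 'a set" and \<rho> :: real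
  assumes chain: "n \<ge> 1 \<Longrightarrow> tree_chain (\<U> n)"
    and refines: "n \<ge> 1 \<Longrightarrow> strongly_refines (\<U> (Suc n)) (\<U> n)"
    and pos: "\<rho> > 0"
    and small: "\<lbrakk>n \<ge> 2; U \<in> \<U> n; x \<in> U; y \<in> U\<rbrakk> \<Longrightarrow> dist x y < \<rho> / 2 ^ n"
    and gap: "\<lbrakk>U \<in> \<U> 1; V \<in> \<U> 1; U \<inter> V = {}; x \<in> U; y \<in> V\<rbrakk> \<Longrightarrow> \<rho> \<le> dist x y"
    and \<phi>_mem: "\<lbrakk>n \<ge> 1; V \<in> \<U> (Suc n)\<rbrakk> \<Longrightarrow> \<phi> n V \<in> \<U> n"
    and D1: "\<lbrakk>U \<in> \<U> 1; V \<in> \<U> 2; U \<inter> V \<noteq> {}\<rbrakk> \<Longrightarrow> \<phi> 1 V \<inter> U = {}"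
    and D2: "\<lbrakk>n \<ge> 1; U \<in> \<U> (Suc (Suc n)); V \<in> \<U> (Suc n); U \<inter> V \<noteq> {}\<rbrakk> \<Longrightarrow> \<phi> (Suc n) U \<inter> \<phi> n V \<noteq> {}"
    and D3: "\<lbrakk>n \<ge> 1; U \<in> \<U> (Suc n); V \<in> \<U> (Suc n); U \<inter> V \<noteq> {}\<rbrakk> \<Longrightarrow> \<phi> n U \<inter> \<phi> n V \<noteq> {}"
begin

definition X :: "'a set" where "X = (\<Inter>n\<in>{1..}. \<Union>(\<U> n))"

lemma finite_U: "n \<ge> 1 \<Longrightarrow> finite (\<U> n)"
  using chain unfolding tree_chain_def by blast

lemma open_U: "n \<ge> 1 \<Longrightarrow> U \<in> \<U> n \<Longrightarrow> open U"
  using chain unfolding tree_chain_def by blast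

lemma closure_step: "n \<ge> 1 \<Longrightarrow> closure (\<Union>(\<U> (Suc n))) \<subseteq> \<Union>(\<U> n)"
proof -
  assume n: "n \<ge> 1"
  have "closed (\<Union>V\<in>\<U> (Suc n). closure V)"
    using finite_U[of "Suc n"] by (intro closed_UN) auto
  then have "closure (\<Union>(\<U> (Suc n))) \<subseteq> (\<Union>V\<in>\<U> (Suc n). closure V)"
    using closure_subset by (intro closure_minimal) blast+
  then show ?thesis using refines[OF n] unfolding strongly_refines_def by blast
qed

lemma Union_antimono: "\<lbrakk>1 \<le> m; m \<le> n\<rbrakk> \<Longrightarrow> \<Union>(\<U> n) \<subseteq> \<Union>(\<U> m)"
proof -
  assume m: "1 \<le> m" and "m \<le> n"
  from \<open>m \<le> n\<close> show "\<Union>(\<U> n) \<subseteq> \<Union>(\<U> m)"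
  proof (induction n rule: dec_induct)
    case base
    show ?case by (rule order_refl)
  next
    case (step n)
    have "1 \<le> n" using m step.hyps(1) by simp
    from order_trans[OF closure_subset closure_step[OF this]] step.IH show ?case by (rule order_trans)
  qed
qed

definition C :: "nat \<Rightarrow> 'a set" where "C n = closure (\<Union>(\<U> (Suc (Suc n))))"

lemma C_antimono: "m \<le> n \<Longrightarrow> C n \<subseteq> C m"
  unfolding C_def by (intro closure_mono Union_antimono) auto

text \<open>
  Members of the first family may be unbounded. This is why the compact sets \<open>C n\<close> start at the
  second one.
\<close>

lemma compact_C: "compact (C n)"
proof -
  have "bounded U" if U: "U \<in> \<U> (Suc (Suc n))" for U
  proof (cases "U = {}")
    case False
    then obtain x where x: "x \<in> U" by blast
    have "\<forall>y\<in>U. dist x y \<le> \<rho> / 2 ^ Suc (Suc n)"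
      using small[OF _ U x] by (intro ballI less_imp_le) auto
    then show ?thesis unfolding bounded_def by blast
  qed simp
  then have "bounded (\<Union>(\<U> (Suc (Suc n))))"
    using finite_U[of "Suc (Suc n)"] by (simp add: bounded_Union)
  then show ?thesis unfolding C_def by (simp add: compact_closure)
qed

lemma X_eq_C: "X = (\<Inter>n. C n)"
proof
  show "X \<subseteq> (\<Inter>n. C n)"
    unfolding X_def C_def using closure_subset by fastforce
  show "(\<Inter>n. C n) \<subseteq> X"
  proof
    fix x assume x: "x \<in> (\<Inter>n. C n)"
    show "x \<in> X" unfolding X_def
    proof
      fix n :: nat assume n: "n \<in> {1..}"
      then have "x \<in> C (n - 1)" "Suc (Suc (n - 1)) = Suc n" using x by auto
      then show "x \<in> \<Union>(\<U> n)" using closure_step[of n] n unfolding C_def by auto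
    qed
  qed
qed

lemma compact_X: "compact X"
proof -
  have "closed X" unfolding X_eq_C using compact_C compact_imp_closed by (intro closed_INT) blast
  moreover have "bounded X"
    using bounded_subset[OF compact_imp_bounded[OF compact_C[of 0]]] unfolding X_eq_C by blast
  ultimately show ?thesis by (simp add: compact_eq_bounded_closed)
qed

text \<open>
  \<open>X\<close> is the intersection of a decreasing sequence of compact sets, so each open set around \<open>X\<close>
  contains almost all of them.
\<close>

lemma chain_in_nbhd:
  assumes "open W" "X \<subseteq> W"
  obtains N where "\<And>n. n \<ge> N \<Longrightarrow> \<Union>(\<U> n) \<subseteq> W"
proof -
  have "\<exists>n. C n - W = {}"
  proof (rule ccontr)
    assume "\<not> ?thesis"
    then have "(\<Inter>n. C n - W) \<noteq> {}"
      using compact_C assms(1)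
      by (intro compact_nest Diff_mono C_antimono) (auto intro: compact_diff)
    then show False using assms(2) unfolding X_eq_C by blast
  qed
  then obtain n where n: "C n \<subseteq> W" by blast
  have "\<Union>(\<U> k) \<subseteq> W" if "k \<ge> Suc (Suc n)" for k
    using Union_antimono[of "Suc (Suc n)" k] that n closure_subset unfolding C_def by fastforce
  then show thesis by (rule that)
qed

lemma X_nonempty: "X \<noteq> {}"
proof
  assume "X = {}"
  then obtain N where N: "\<And>n. n \<ge> N \<Longrightarrow> \<Union>(\<U> n) \<subseteq> {}" using chain_in_nbhd[of "{}"] by auto
  have "\<Union>(\<U> (Suc N)) = {}" using N[of "Suc N"] by simp
  then show False using tree_chain_nerve(3)[OF chain[of "Suc N"]] by auto
qed

lemma scale_small:
  assumes "e > 0"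
  obtains N where "\<And>n. n \<ge> N \<Longrightarrow> \<rho> / 2 ^ n < e"
proof -
  have "(\<lambda>n. \<rho> / 2 ^ n) \<longlonglongrightarrow> 0"
    using LIMSEQ_divide_realpow_zero[of 2 \<rho>] by simp
  then have "\<forall>\<^sub>F n in sequentially. \<rho> / 2 ^ n < e"
    using assms by (intro order_tendstoD(2)) auto
  then show thesis using that unfolding eventually_sequentially by blast
qed

text \<open>
  The members of the chains need not be connected, only small. If \<open>X\<close> split into two compact sets
  at distance \<open>d\<close>, a chain with links shorter than \<open>d / 3\<close> that lies in the \<open>d / 3\<close>-neighbourhoods of
  the two parts would have no link that meets both neighbourhoods. The links that meet the first one
  would then be a side of a cut of the nerve that no edge crosses.
\<close>

lemma connected_X: "connected X"
proof (rule ccontr)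
  assume "\<not> connected X"
  then obtain A B where AB: "closedin (top_of_set X) A" "closedin (top_of_set X) B"
    "A \<union> B = X" "A \<inter> B = {}" "A \<noteq> {}" "B \<noteq> {}"
    unfolding connected_closedin_eq by blast
  have cpt: "compact A" "compact B" using AB compact_X closedin_compact by auto
  obtain d where d: "d > 0" "\<And>a b. \<lbrakk>a \<in> A; b \<in> B\<rbrakk> \<Longrightarrow> d \<le> dist a b"
    using separate_compact_closed[OF cpt(1) compact_imp_closed[OF cpt(2)] AB(4)] by blast
  define P Q where "P = (\<Union>a\<in>A. ball a (d / 3))" and "Q = (\<Union>b\<in>B. ball b (d / 3))"
  have "A \<subseteq> P" "B \<subseteq> Q" using d(1) unfolding P_def Q_def by auto
  moreover have "open P" "open Q" unfolding P_def Q_def by auto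
  ultimately have "open (P \<union> Q)" "X \<subseteq> P \<union> Q" using AB(3) by auto
  then obtain N where N: "\<And>n. n \<ge> N \<Longrightarrow> \<Union>(\<U> n) \<subseteq> P \<union> Q" using chain_in_nbhd by metis
  obtain M where M: "\<And>n. n \<ge> M \<Longrightarrow> \<rho> / 2 ^ n < d / 3"
    using scale_small[of "d / 3"] d(1) by (metis divide_pos_pos zero_less_numeral)
  define n where "n = max 2 (max N M)"
  have n: "n \<ge> 2" "n \<ge> 1" "n \<ge> N" "n \<ge> M" by (auto simp: n_def)
  have far: False if U: "U \<in> \<U> n" "p \<in> U" "q \<in> U" and pq: "p \<in> P" "q \<in> Q" for U p q
  proof -
    obtain a b where ab: "a \<in> A" "dist a p < d / 3" "b \<in> B" "dist b q < d / 3"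
      using pq unfolding P_def Q_def by auto
    have "dist p q < d / 3" using small[OF n(1) U] M[OF n(4)] by linarith
    moreover have "d \<le> dist a b" using d(2) ab by blast
    moreover have "dist a b \<le> dist a p + dist p q + dist b q"
      by (metis add.commute add_left_mono dist_commute dist_triangle dist_triangle_le group_cancel.add2)
    ultimately show False using ab(2,4) by linarith
  qed
  define S where "S = {U \<in> \<U> n. U \<inter> P \<noteq> {}}"
  obtain a b where ab: "a \<in> A" "b \<in> B" using AB by blast
  have "a \<in> \<Union>(\<U> n)" "b \<in> \<Union>(\<U> n)" using ab AB(3) n(2) unfolding X_def by auto
  then obtain U V where U: "U \<in> \<U> n" "a \<in> U" and V: "V \<in> \<U> n" "b \<in> V" by blast
  have "{U} \<in> nerve (\<U> n)" "{V} \<in> nerve (\<U> n)" using U V unfolding singleton_in_nerve by auto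
  moreover have "U \<in> S" using U ab \<open>A \<subseteq> P\<close> unfolding S_def by auto
  moreover have "V \<notin> S" using far[OF V(1) _ V(2)] ab \<open>B \<subseteq> Q\<close> unfolding S_def by blast
  ultimately obtain Y Z where YZ: "Y \<in> S" "Z \<notin> S" "{Y, Z} \<in> nerve (\<U> n)"
    using every_cut_crossedD[OF tree_chain_nerve(2)[OF chain[OF n(2)]]] by metis
  then have YZ': "Y \<in> \<U> n" "Z \<in> \<U> n" "Y \<inter> Z \<noteq> {}" unfolding pair_in_nerve by auto
  then obtain z where z: "z \<in> Y" "z \<in> Z" by blast
  have "z \<notin> P" using YZ(2) YZ'(2) z unfolding S_def by blast
  then have "z \<in> Q" using N[OF n(3)] z YZ' by blast
  moreover obtain p where "p \<in> Y" "p \<in> P" using YZ(1) unfolding S_def by blast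
  ultimately show False using far[OF YZ'(1) _ z(1)] by blast
qed

definition link :: "nat \<Rightarrow> 'a \<Rightarrow> 'a set" where
  "link n x = (SOME V. V \<in> \<U> (Suc n) \<and> x \<in> V)"

lemma link: assumes "x \<in> X" shows "link n x \<in> \<U> (Suc n)" "x \<in> link n x"
proof -
  have "\<exists>V. V \<in> \<U> (Suc n) \<and> x \<in> V" using assms unfolding X_def by auto
  from someI_ex[OF this] show "link n x \<in> \<U> (Suc n)" "x \<in> link n x" unfolding link_def by auto
qed

text \<open>
  The links \<open>\<phi> n (link n x)\<close> get smaller, and by the second pattern condition consecutive
  ones meet. A sequence of points in these intersections converges; its limit is the image of \<open>x\<close> under
  the map without fixed points.
\<close>

definition orbit :: "'a \<Rightarrow> nat \<Rightarrow> 'a" where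
  "orbit x n = (SOME z. z \<in> \<phi> n (link n x) \<inter> \<phi> (Suc n) (link (Suc n) x))"

lemma orbit:
  assumes "x \<in> X" "n \<ge> 1"
  shows "orbit x n \<in> \<phi> n (link n x)" "orbit x n \<in> \<phi> (Suc n) (link (Suc n) x)"
proof -
  have "link (Suc n) x \<inter> link n x \<noteq> {}" using link(2)[OF assms(1)] by blast
  then have "\<phi> (Suc n) (link (Suc n) x) \<inter> \<phi> n (link n x) \<noteq> {}"
    using D2[OF assms(2)] link(1)[OF assms(1)] by blast
  then have "\<exists>z. z \<in> \<phi> n (link n x) \<inter> \<phi> (Suc n) (link (Suc n) x)" by blast
  from someI_ex[OF this] show "orbit x n \<in> \<phi> n (link n x)" "orbit x n \<in> \<phi> (Suc n) (link (Suc n) x)"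
    unfolding orbit_def by auto
qed

definition pattern_map :: "'a \<Rightarrow> 'a" where
  "pattern_map x = lim (orbit x)"

lemma \<phi>_link: "\<lbrakk>x \<in> X; n \<ge> 1\<rbrakk> \<Longrightarrow> \<phi> n (link n x) \<in> \<U> n"
  using \<phi>_mem link(1) by blast

lemma pattern_map:
  assumes x: "x \<in> X"
  shows "orbit x \<longlonglongrightarrow> pattern_map x" "n \<ge> 1 \<Longrightarrow> dist (orbit x n) (pattern_map x) \<le> \<rho> / 2 ^ n"
proof -
  have "dist (orbit x n) (orbit x (Suc n)) \<le> \<rho> / 2 ^ Suc n" if "n \<ge> 1" for n
    using small[OF _ \<phi>_link[OF x] orbit(2)[OF x that] orbit(1)[OF x]] that by (simp add: less_imp_le)
  then obtain l where l: "orbit x \<longlonglongrightarrow> l" "\<And>n. n \<ge> 1 \<Longrightarrow> dist (orbit x n) l \<le> \<rho> / 2 ^ n"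
    using convergent_of_halving_steps[of 1 "orbit x" \<rho>] by metis
  have "pattern_map x = l" unfolding pattern_map_def using l(1) by (rule limI)
  then show "orbit x \<longlonglongrightarrow> pattern_map x" "n \<ge> 1 \<Longrightarrow> dist (orbit x n) (pattern_map x) \<le> \<rho> / 2 ^ n" using l by auto
qed

lemma pattern_map_in_X: assumes x: "x \<in> X" shows "pattern_map x \<in> X"
  unfolding X_def
proof
  fix n :: nat assume n: "n \<in> {1..}"
  have "\<forall>\<^sub>F k in sequentially. orbit x k \<in> closure (\<Union>(\<U> (Suc n)))"
    unfolding eventually_sequentially
  proof (intro exI allI impI)
    fix k assume k: "Suc n \<le> k"
    have "1 \<le> k" using k by simp
    then have "orbit x k \<in> \<Union>(\<U> k)" using orbit(1)[OF x] \<phi>_link[OF x] by blast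
    then have "orbit x k \<in> \<Union>(\<U> (Suc n))" using Union_antimono[of "Suc n" k] k by auto
    then show "orbit x k \<in> closure (\<Union>(\<U> (Suc n)))" by (rule subsetD[OF closure_subset])
  qed
  then have "pattern_map x \<in> closure (\<Union>(\<U> (Suc n)))"
    using Lim_in_closed_set[OF closed_closure _ _ pattern_map(1)[OF x]] by simp
  then show "pattern_map x \<in> \<Union>(\<U> n)" using closure_step n by auto
qed

text \<open>
  The chosen links of \<open>x\<close> and \<open>y\<close> both meet \<open>V\<close>, so by the third pattern condition their images meet
  the image of \<open>V\<close>. The factor \<open>5\<close> counts three links and the distances of the two orbits to their limits.
  The links chosen for \<open>x\<close> and \<open>y\<close> may differ, which is why \<open>V\<close> serves as an intermediary.
\<close>

lemma pattern_map_close: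
  assumes xy: "x \<in> X" "y \<in> X" and n: "n \<ge> 2" and V: "V \<in> \<U> (Suc n)" "x \<in> V" "y \<in> V"
  shows "dist (pattern_map x) (pattern_map y) < 5 * (\<rho> / 2 ^ n)"
proof -
  have n1: "n \<ge> 1" using n by simp
  have "\<exists>p. p \<in> \<phi> n (link n u) \<inter> \<phi> n V" if "u \<in> X" "u \<in> V" for u
    using D3[OF n1 link(1)[OF that(1)] V(1)] link(2)[OF that(1)] that(2) by blast
  then obtain p q where p: "p \<in> \<phi> n (link n x)" "p \<in> \<phi> n V" and q: "q \<in> \<phi> n (link n y)" "q \<in> \<phi> n V"
    using xy V by blast
  have "dist (orbit x n) p < \<rho> / 2 ^ n" by (rule small[OF n \<phi>_link[OF xy(1) n1] orbit(1)[OF xy(1) n1] p(1)])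
  moreover have "dist (orbit y n) q < \<rho> / 2 ^ n" by (rule small[OF n \<phi>_link[OF xy(2) n1] orbit(1)[OF xy(2) n1] q(1)])
  moreover have "dist p q < \<rho> / 2 ^ n" by (rule small[OF n \<phi>_mem[OF n1 V(1)] p(2) q(2)])
  moreover have "dist (orbit x n) (pattern_map x) \<le> \<rho> / 2 ^ n" "dist (orbit y n) (pattern_map y) \<le> \<rho> / 2 ^ n"
    using pattern_map(2) xy n1 by auto
  moreover have "dist (pattern_map x) (pattern_map y) \<le> dist (orbit x n) (pattern_map x) + dist (orbit x n) p + dist p q + dist (orbit y n) q + dist (orbit y n) (pattern_map y)"
    using dist_triangle3[of "pattern_map x" "pattern_map y" "orbit x n"] dist_triangle[of "orbit x n" "pattern_map y" p]
      dist_triangle[of p "pattern_map y" q] dist_triangle3[of q "pattern_map y" "orbit y n"] by linarith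
  ultimately show ?thesis by linarith
qed

lemma continuous_pattern_map: "continuous_on X pattern_map"
  unfolding continuous_on_iff
proof (intro ballI allI impI)
  fix x and e :: real assume x: "x \<in> X" and e: "e > 0"
  obtain N where N: "\<And>n. n \<ge> N \<Longrightarrow> \<rho> / 2 ^ n < e / 5" using scale_small[of "e / 5"] e by auto
  define n where "n = max 2 N"
  have n: "n \<ge> 2" "n \<ge> N" by (auto simp: n_def)
  have "open (link n x)" using open_U[of "Suc n"] link(1)[OF x] by simp
  then obtain d where d: "d > 0" "ball x d \<subseteq> link n x"
    using link(2)[OF x] openE by blast
  have "dist (pattern_map y) (pattern_map x) < e" if y: "y \<in> X" "dist y x < d" for y
  proof -
    have "y \<in> link n x" using d(2) y(2) by (auto simp: dist_commute)
    then have "dist (pattern_map y) (pattern_map x) < 5 * (\<rho> / 2 ^ n)"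
      using pattern_map_close[OF y(1) x n(1) link(1)[OF x]] link(2)[OF x] by blast
    then show ?thesis using N[OF n(2)] by linarith
  qed
  then show "\<exists>d>0. \<forall>y\<in>X. dist y x < d \<longrightarrow> dist (pattern_map y) (pattern_map x) < e" using d(1) by blast
qed

text \<open>
  By the first pattern condition the first link on the way to the image of \<open>x\<close> is disjoint from a
  member of the first chain that contains \<open>x\<close>, so it is at distance at least \<open>\<rho>\<close> from \<open>x\<close>. The limit is at
  most \<open>\<rho> / 2\<close> away from the point \<open>orbit x 1\<close> of that link.
\<close>

lemma pattern_map_moves: assumes x: "x \<in> X" shows "pattern_map x \<noteq> x"
proof
  assume fixed: "pattern_map x = x"
  have "x \<in> \<Union>(\<U> 1)" using x unfolding X_def by simp
  then obtain U where U: "U \<in> \<U> 1" "x \<in> U" by blast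
  have V: "link 1 x \<in> \<U> 2" "x \<in> link 1 x" using link[OF x, of 1] by (simp_all add: numeral_2_eq_2)
  have "\<phi> 1 (link 1 x) \<inter> U = {}" using D1[OF U(1) V(1)] U(2) V(2) by blast
  then have "\<rho> \<le> dist (orbit x 1) x"
    using gap[OF \<phi>_link[OF x] U(1) _ orbit(1)[OF x] U(2)] by simp
  moreover have "dist (orbit x 1) (pattern_map x) \<le> \<rho> / 2" using pattern_map(2)[OF x, of 1] by simp
  ultimately show False using fixed pos by simp
qed

lemma not_fixed_point_property: "\<not> fixed_point_property X"
  unfolding fixed_point_property_def using continuous_pattern_map pattern_map_in_X pattern_map_moves by blast

text \<open>
  A chain that is finer than the given cover, restricted to \<open>X\<close>, is the required refinement. Its nerve can
  be smaller than that of the chain, because links that meet in the ambient space need not meet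
  inside \<open>X\<close>. Two points of \<open>X\<close> for which the chain must be so fine that no link
  contains both are a point and its image under the map without fixed points.
\<close>

lemma tree_like_X: "tree_like_continuum X"
  unfolding tree_like_continuum_def continuum_def
proof (intro conjI allI impI)
  show "X \<noteq> {}" "compact X" "connected X" by (rule X_nonempty compact_X connected_X)+
  show "metrizable_space (top_of_set X)"
    by (simp add: metrizable_space_subtopology metrizable_space_euclidean)
  fix \<C> assume \<C>: "open_cover_of X \<C>"
  have "\<exists>T. open T \<and> c = X \<inter> T" if "c \<in> \<C>" for c
    using \<C> that unfolding open_cover_of_def openin_open by blast
  then obtain T where T: "\<And>c. c \<in> \<C> \<Longrightarrow> open (T c) \<and> c = X \<inter> T c" by metis
  have "X \<subseteq> \<Union>(T ` \<C>)" using \<C> T unfolding open_cover_of_def by blast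
  then obtain e where e: "e > 0" "\<And>x. x \<in> X \<Longrightarrow> \<exists>G\<in>T ` \<C>. ball x e \<subseteq> G"
    using Heine_Borel_lemma[OF compact_X, of "T ` \<C>"] T by (metis (no_types, lifting) imageE)
  obtain a where a: "a \<in> X" using X_nonempty by blast
  define b where "b = pattern_map a"
  have b: "b \<in> X" "a \<noteq> b" using pattern_map_in_X[OF a] pattern_map_moves[OF a] unfolding b_def by auto
  obtain N where N: "\<And>n. n \<ge> N \<Longrightarrow> \<rho> / 2 ^ n < min e (dist a b)"
    using scale_small[of "min e (dist a b)"] e(1) b(2) by auto
  define n where "n = max 2 N"
  have n: "n \<ge> 2" "n \<ge> N" "n \<ge> 1" by (auto simp: n_def)
  define \<G> where "\<G> = (\<lambda>U. U \<inter> X) ` \<U> n - {{}}"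
  define h where "h G = (SOME U. U \<in> \<U> n \<and> G = U \<inter> X)" for G
  have h: "h G \<in> \<U> n" "G = h G \<inter> X" if "G \<in> \<G>" for G
  proof -
    have "\<exists>U. U \<in> \<U> n \<and> G = U \<inter> X" using that unfolding \<G>_def by blast
    from someI_ex[OF this] show "h G \<in> \<U> n" "G = h G \<inter> X" unfolding h_def by auto
  qed
  have small_G: "dist x y < min e (dist a b)" if "G \<in> \<G>" "x \<in> G" "y \<in> G" for G x y
    using small[OF n(1) h(1)[OF that(1)], of x y] h(2)[OF that(1)] that N[OF n(2)] by fastforce
  have fin: "finite \<G>" unfolding \<G>_def using finite_U[OF n(3)] by simp
  have cover: "\<Union>\<G> = X"
  proof
    show "\<Union>\<G> \<subseteq> X" unfolding \<G>_def by blast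
    show "X \<subseteq> \<Union>\<G>"
    proof
      fix x assume x: "x \<in> X"
      then have "x \<in> \<Union>(\<U> n)" using n(3) unfolding X_def by auto
      then show "x \<in> \<Union>\<G>" using x unfolding \<G>_def by blast
    qed
  qed
  have op: "openin (top_of_set X) G" if "G \<in> \<G>" for G
  proof -
    have "openin (top_of_set X) (X \<inter> h G)"
      using open_U[OF n(3) h(1)[OF that]] by (rule openin_open_Int)
    then show ?thesis using h(2)[OF that] by (simp add: Int_commute)
  qed
  have "is_tree (geometric_realization (nerve \<G>))"
  proof (rule subordinate_cover_nerve_tree[OF fin tree_chain_nerve(1)[OF chain[OF n(3)]] connected_X X_nonempty])
    show "X \<subseteq> \<Union>\<G>" using cover by simp
    show "inj_on h \<G>" using h(2) by (metis inj_onI)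
    fix G assume G: "G \<in> \<G>"
    have "G \<inter> X = G" using h(2)[OF G] by blast
    then show "openin (top_of_set X) (G \<inter> X)" using op[OF G] by simp
    show "G \<noteq> {} \<Longrightarrow> G \<inter> X \<noteq> {}" using \<open>G \<inter> X = G\<close> by simp
    show "\<not> X \<subseteq> G" using small_G[OF G, of a b] a b by auto
    show "h G \<in> \<U> n" by (rule h(1)[OF G])
    fix H assume "H \<in> \<G>" "G \<inter> H \<noteq> {}"
    then show "h G \<inter> h H \<noteq> {}" using h(2)[OF G] h(2)[of H] by blast
  qed
  moreover have "\<exists>c\<in>\<C>. G \<subseteq> c" if G: "G \<in> \<G>" for G
  proof -
    obtain x where x: "x \<in> G" using G unfolding \<G>_def by blast
    have GX: "G \<subseteq> X" using cover G by blast
    then obtain c where c: "c \<in> \<C>" "ball x e \<subseteq> T c" using e(2)[of x] x by blast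
    have "G \<subseteq> ball x e" using small_G[OF G x] by auto
    then have "G \<subseteq> c" using c T[OF c(1)] GX by blast
    then show ?thesis using c(1) by blast
  qed
  ultimately show "\<exists>\<V>. finite \<V> \<and> open_cover_of X \<V> \<and> (\<forall>V\<in>\<V>. \<exists>C\<in>\<C>. V \<subseteq> C) \<and>
           is_tree (geometric_realization (nerve \<V>))"
    unfolding open_cover_of_def using fin cover op by (intro exI[of _ \<G>]) blast
qed

end

lemma dist_le_ediameter: "\<lbrakk>x \<in> A; y \<in> A\<rbrakk> \<Longrightarrow> ennreal (dist x y) \<le> ediameter A"
  unfolding ediameter_def by (rule SUP_upper2[of x], assumption, rule SUP_upper)

lemma dist_le_mesh: "\<lbrakk>U \<in> \<U>; x \<in> U; y \<in> U\<rbrakk> \<Longrightarrow> ennreal (dist x y) \<le> mesh \<U>"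
  unfolding mesh_def by (rule SUP_upper2[of U], assumption, rule dist_le_ediameter)

lemma min_gap_le_dist:
  "\<lbrakk>U \<in> \<U>; V \<in> \<U>; U \<inter> V = {}; x \<in> U; y \<in> V\<rbrakk> \<Longrightarrow> min_gap \<U> \<le> ennreal (dist x y)"
proof -
  assume a: "U \<in> \<U>" "V \<in> \<U>" "U \<inter> V = {}" "x \<in> U" "y \<in> V"
  have "min_gap \<U> \<le> set_edist U V" unfolding min_gap_def using a by (intro Inf_lower) auto
  also have "\<dots> \<le> ennreal (dist x y)"
    unfolding set_edist_def by (rule INF_lower2[OF a(4)], rule INF_lower[OF a(5)])
  finally show ?thesis .
qed

text \<open>
  The gap is positive because the mesh is less than a fraction of it, and finite because the first
  pattern condition, applied to a nonempty link of the second chain, produces two nonempty disjoint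
  members of the first chain.
\<close>

lemma pattern_sequence_of_fixed_point_free:
  fixes \<U> :: "nat \<Rightarrow> 'a::heine_borel set set"
  assumes "fixed_point_free_tree_chain_sequence \<U>"
  shows "\<exists>\<phi> \<rho>. pattern_sequence \<U> \<phi> \<rho>"
proof -
  have chain: "\<And>n. n \<ge> 1 \<Longrightarrow> tree_chain (\<U> n)"
    and refines: "\<And>n. n \<ge> 1 \<Longrightarrow> strongly_refines (\<U> (n + 1)) (\<U> n)"
    and mesh: "\<And>n. n \<ge> 2 \<Longrightarrow> mesh (\<U> n) < min_gap (\<U> 1) / 2 ^ n"
    and pattern: "follows_fixed_point_free_pattern \<U>"
    using assms unfolding fixed_point_free_tree_chain_sequence_def by auto
  obtain \<phi> where \<phi>: "\<forall>n\<ge>1. \<forall>V\<in>\<U> (n + 1). \<phi> n V \<in> \<U> n"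
    "\<forall>U\<in>\<U> 1. \<forall>V\<in>\<U> 2. U \<inter> V \<noteq> {} \<longrightarrow> \<phi> 1 V \<inter> U = {}"
    "\<forall>n\<ge>1. \<forall>U\<in>\<U> (n + 2). \<forall>V\<in>\<U> (n + 1). U \<inter> V \<noteq> {} \<longrightarrow> \<phi> (n + 1) U \<inter> \<phi> n V \<noteq> {}"
    "\<forall>n\<ge>1. \<forall>U\<in>\<U> (n + 1). \<forall>V\<in>\<U> (n + 1). U \<inter> V \<noteq> {} \<longrightarrow> \<phi> n U \<inter> \<phi> n V \<noteq> {}"
    using pattern unfolding follows_fixed_point_free_pattern_def by (elim exE conjE) (rule that)
  note mem = \<phi>(1)[rule_format] and D1 = \<phi>(2)[rule_format]
    and D2 = \<phi>(3)[rule_format] and D3 = \<phi>(4)[rule_format]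
  have "(0::ennreal) < min_gap (\<U> 1)"
    using mesh[of 2] by (metis ennreal_zero_divide not_gr_zero not_less_zero order_refl)
  moreover have "min_gap (\<U> 1) < top"
  proof -
    obtain V where V: "V \<in> \<U> 2" "V \<noteq> {}" using tree_chain_nerve(3)[OF chain[of 2]] by auto
    obtain U where U: "U \<in> \<U> 1" "closure V \<subseteq> U"
      using refines[of 1] V(1) unfolding strongly_refines_def by (auto simp: numeral_2_eq_2)
    have "U \<inter> V \<noteq> {}" using U V closure_subset by blast
    then have dj: "\<phi> 1 V \<inter> U = {}" "\<phi> 1 V \<in> \<U> 1" "\<phi> 1 V \<noteq> {}"
      using D1[OF U(1) V(1)] mem[of 1 V] D3[of 1 V V] V by (auto simp: numeral_2_eq_2)
    obtain x y where "x \<in> \<phi> 1 V" "y \<in> U" using dj(3) \<open>U \<inter> V \<noteq> {}\<close> by blast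
    then have "min_gap (\<U> 1) \<le> ennreal (dist x y)" using min_gap_le_dist dj U(1) by blast
    also have "\<dots> < top" by simp
    finally show ?thesis .
  qed
  ultimately obtain \<rho> where \<rho>: "\<rho> > 0" "min_gap (\<U> 1) = ennreal \<rho>"
    by (metis ennreal_0 ennreal_cases less_irrefl order_le_less top.not_eq_extremum)
  have scaled: "ennreal \<rho> / 2 ^ n = ennreal (\<rho> / 2 ^ n)" for n
  proof -
    have "(2::ennreal) ^ n = ennreal (2 ^ n)" by (simp add: ennreal_power flip: ennreal_numeral)
    then show ?thesis using \<rho>(1) by (simp add: divide_ennreal)
  qed
  have "pattern_sequence \<U> \<phi> \<rho>"
  proof
    show "tree_chain (\<U> n)" if "n \<ge> 1" for n using chain that by blast
    show "strongly_refines (\<U> (Suc n)) (\<U> n)" if "n \<ge> 1" for n using refines[OF that] by simp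
    show "\<rho> > 0" by (rule \<rho>(1))
    show "dist x y < \<rho> / 2 ^ n" if "n \<ge> 2" "U \<in> \<U> n" "x \<in> U" "y \<in> U" for n U x y
    proof -
      have "ennreal (dist x y) < ennreal (\<rho> / 2 ^ n)"
        using dist_le_mesh[OF that(2-4)] mesh[OF that(1)] unfolding \<rho>(2) scaled by (rule order_le_less_trans)
      then show ?thesis by (simp add: ennreal_less_iff)
    qed
    show "\<rho> \<le> dist x y" if "U \<in> \<U> 1" "V \<in> \<U> 1" "U \<inter> V = {}" "x \<in> U" "y \<in> V" for U V x y
      using min_gap_le_dist[OF that] unfolding \<rho>(2) by simp
    show "\<phi> n V \<in> \<U> n" if "n \<ge> 1" "V \<in> \<U> (Suc n)" for n V using mem[of n V] that by simp
    show "\<phi> 1 V \<inter> U = {}" if "U \<in> \<U> 1" "V \<in> \<U> 2" "U \<inter> V \<noteq> {}" for U V using D1 that by blast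
    show "\<phi> (Suc n) U \<inter> \<phi> n V \<noteq> {}"
      if "n \<ge> 1" "U \<in> \<U> (Suc (Suc n))" "V \<in> \<U> (Suc n)" "U \<inter> V \<noteq> {}" for n U V using D2[of n U V] that by simp
    show "\<phi> n U \<inter> \<phi> n V \<noteq> {}"
      if "n \<ge> 1" "U \<in> \<U> (Suc n)" "V \<in> \<U> (Suc n)" "U \<inter> V \<noteq> {}" for n U V using D3[of n U V] that by simp
  qed
  then show ?thesis by blast
qed

lemma fixed_point_free_sequence_intersection:
  fixes \<U> :: "nat \<Rightarrow> 'a::heine_borel set set"
  assumes "fixed_point_free_tree_chain_sequence \<U>"
  shows "tree_like_continuum (\<Inter>n\<in>{1..}. \<Union>(\<U> n))" "\<not> fixed_point_property (\<Inter>n\<in>{1..}. \<Union>(\<U> n))"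
proof -
  obtain \<phi> \<rho> where "pattern_sequence \<U> \<phi> \<rho>" using pattern_sequence_of_fixed_point_free[OF assms] by blast
  then interpret pattern_sequence \<U> \<phi> \<rho> .
  show "tree_like_continuum (\<Inter>n\<in>{1..}. \<Union>(\<U> n))" "\<not> fixed_point_property (\<Inter>n\<in>{1..}. \<Union>(\<U> n))"
    using tree_like_X not_fixed_point_property unfolding X_def by auto
qed

section \<open>A map without fixed points on a tree-like continuum gives a pattern sequence\<close>

text \<open>
  Besides a bound on the size of the links, two properties that make the chain reflect \<open>X\<close>: links that
  meet do so inside \<open>X\<close>, and disjoint links have a positive distance. The last property implies
  tautness and a positive \<open>min_gap\<close> at once.
\<close>

definition fine_chain :: "'a::metric_space set \<Rightarrow> 'a set set \<Rightarrow> real \<Rightarrow> bool" where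
  "fine_chain X \<U> r \<longleftrightarrow> tree_chain \<U> \<and> X \<subseteq> \<Union>\<U> \<and>
    (\<forall>U\<in>\<U>. \<exists>y\<in>X. closure U \<subseteq> ball y r) \<and>
    (\<forall>U\<in>\<U>. \<forall>V\<in>\<U>. U \<inter> V \<noteq> {} \<longrightarrow> U \<inter> V \<inter> X \<noteq> {}) \<and>
    (\<exists>d>0. \<forall>U\<in>\<U>. \<forall>V\<in>\<U>. U \<inter> V = {} \<longrightarrow> (\<forall>x\<in>U. \<forall>y\<in>V. d \<le> dist x y))"

lemma fine_chainD:
  assumes "fine_chain X \<U> r"
  shows "tree_chain \<U>" "X \<subseteq> \<Union>\<U>" "\<forall>U\<in>\<U>. \<exists>y\<in>X. closure U \<subseteq> ball y r"
    "\<forall>U\<in>\<U>. \<forall>V\<in>\<U>. U \<inter> V \<noteq> {} \<longrightarrow> U \<inter> V \<inter> X \<noteq> {}"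
    "\<exists>d>0. \<forall>U\<in>\<U>. \<forall>V\<in>\<U>. U \<inter> V = {} \<longrightarrow> (\<forall>x\<in>U. \<forall>y\<in>V. d \<le> dist x y)"
proof -
  note a = assms[unfolded fine_chain_def]
  show "tree_chain \<U>" by (rule conjunct1[OF a])
  note a = conjunct2[OF a]
  show "X \<subseteq> \<Union>\<U>" by (rule conjunct1[OF a])
  note a = conjunct2[OF a]
  show "\<forall>U\<in>\<U>. \<exists>y\<in>X. closure U \<subseteq> ball y r" by (rule conjunct1[OF a])
  note a = conjunct2[OF a]
  show "\<forall>U\<in>\<U>. \<forall>V\<in>\<U>. U \<inter> V \<noteq> {} \<longrightarrow> U \<inter> V \<inter> X \<noteq> {}" by (rule conjunct1[OF a])
  show "\<exists>d>0. \<forall>U\<in>\<U>. \<forall>V\<in>\<U>. U \<inter> V = {} \<longrightarrow> (\<forall>x\<in>U. \<forall>y\<in>V. d \<le> dist x y)" by (rule conjunct2[OF a])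
qed

lemma finite_uniform_positive_bound:
  fixes P :: "'i \<Rightarrow> real \<Rightarrow> bool"
  assumes "finite I" and ex: "\<And>i. i \<in> I \<Longrightarrow> \<exists>d>0. P i d"
    and mono: "\<And>i d d'. \<lbrakk>P i d; d' \<le> d\<rbrakk> \<Longrightarrow> P i d'"
  shows "\<exists>d>0. \<forall>i\<in>I. P i d"
  using assms(1) ex
proof (induction I)
  case empty
  show ?case by (auto intro: exI[of _ 1])
next
  case (insert i I)
  then obtain d where d: "d > 0" "\<forall>j\<in>I. P j d" by auto
  obtain d' where d': "d' > 0" "P i d'" using insert.prems by auto
  have "\<forall>j\<in>insert i I. P j (min d d')"
    using d(2) d'(2) mono by (metis insertE min.cobounded1 min.cobounded2)
  then show ?case using d(1) d'(1) by (intro exI[of _ "min d d'"]) auto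
qed

lemma finite_compact_family_gap:
  fixes \<F> :: "'a::heine_borel set set"
  assumes "finite \<F>" and "\<And>F. F \<in> \<F> \<Longrightarrow> compact F"
  shows "\<exists>d>0. \<forall>F\<in>\<F>. \<forall>G\<in>\<F>. F \<inter> G = {} \<longrightarrow> (\<forall>x\<in>F. \<forall>y\<in>G. d \<le> dist x y)"
proof -
  define P where "P p d \<longleftrightarrow> (fst p \<inter> snd p = {} \<longrightarrow> (\<forall>x\<in>fst p. \<forall>y\<in>snd p. d \<le> dist x y))"
    for p :: "'a set \<times> 'a set" and d
  have "\<exists>d>0. \<forall>p\<in>\<F> \<times> \<F>. P p d"
  proof (rule finite_uniform_positive_bound)
    show "finite (\<F> \<times> \<F>)" using assms(1) by simp
    show "P p d'" if "P p d" "d' \<le> d" for p d d'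
      using that unfolding P_def by (meson order_trans)
    fix p assume "p \<in> \<F> \<times> \<F>"
    then have c: "compact (fst p)" "closed (snd p)" using assms(2) by (auto intro: compact_imp_closed)
    show "\<exists>d>0. P p d"
    proof (cases "fst p \<inter> snd p = {}")
      case True
      then show ?thesis using separate_compact_closed[OF c] unfolding P_def by metis
    next
      case False
      then show ?thesis unfolding P_def by (auto intro: exI[of _ 1])
    qed
  qed
  then show ?thesis unfolding P_def by fastforce
qed

text \<open>
  Refine a cover by small balls to a relatively open cover \<open>\<V>\<close> with a tree as nerve, shrink its members
  to compact sets \<open>F V\<close> that still cover \<open>X\<close>, and take \<open>\<delta>\<close>-neighbourhoods of these. For small \<open>\<delta>\<close>
  neighbourhoods meet only if the compact sets do, so that the nerve embeds into that of \<open>\<V>\<close> and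
  meeting links have common points in \<open>X\<close>.
\<close>

lemma fine_chain_exists:
  fixes X :: "'a::heine_borel set"
  assumes tl: "tree_like_continuum X" and ab: "a \<in> X" "b \<in> X" "a \<noteq> b" and r: "r > 0"
  shows "\<exists>\<U>. fine_chain X \<U> r"
proof -
  have X: "X \<noteq> {}" "compact X" "connected X"
    using tl unfolding tree_like_continuum_def continuum_def by blast+
  define s where "s = min (r / 2) (dist a b / 4)"
  have s: "s > 0" "2 * s \<le> r" "4 * s \<le> dist a b" using r ab(3) by (auto simp: s_def min_def)
  define \<C> where "\<C> = (\<lambda>x. X \<inter> ball x s) ` X"
  have "open_cover_of X \<C>" unfolding open_cover_of_def \<C>_def using s(1) by auto
  then obtain \<V> where \<V>: "finite \<V>" "open_cover_of X \<V>" "\<And>V. V \<in> \<V> \<Longrightarrow> \<exists>C\<in>\<C>. V \<subseteq> C"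
    "is_tree (geometric_realization (nerve \<V>))"
    using tl unfolding tree_like_continuum_def by metis
  have "\<exists>T. open T \<and> V = X \<inter> T" if "V \<in> \<V>" for V
    using \<V>(2) that unfolding open_cover_of_def openin_open by blast
  then obtain T where T: "\<And>V. V \<in> \<V> \<Longrightarrow> open (T V) \<and> V = X \<inter> T V" by metis
  have "X \<subseteq> \<Union>(T ` \<V>)" using \<V>(2) T unfolding open_cover_of_def by blast
  then obtain e where e: "e > 0" "\<And>x. x \<in> X \<Longrightarrow> \<exists>G\<in>T ` \<V>. ball x e \<subseteq> G"
    using Heine_Borel_lemma[OF X(2), of "T ` \<V>"] T by (metis (no_types, lifting) imageE)
  \<comment> \<open>e is a Lebesgue number of the cover, so the sets of points deep inside a member still cover X.\<close>
  define F where "F V = X \<inter> {x. ball x e \<subseteq> T V}" for V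
  have F_sub: "F V \<subseteq> V" if "V \<in> \<V>" for V
  proof
    fix x assume x: "x \<in> F V"
    then have "x \<in> T V" using e(1) unfolding F_def by auto
    then show "x \<in> V" using T[OF that] x unfolding F_def by blast
  qed
  have F_cover: "\<exists>V\<in>\<V>. x \<in> F V" if "x \<in> X" for x
    using e(2)[OF that] that unfolding F_def by blast
  have F_compact: "compact (F V)" for V
  proof -
    have "{x. ball x e \<subseteq> T V} = (\<Inter>y\<in>- T V. {x. e \<le> dist x y})"
      by (auto simp: subset_iff not_less[symmetric])
    moreover have "closed (\<Inter>y\<in>- T V. {x. e \<le> dist x y})"
      by (intro closed_INT ballI closed_Collect_le continuous_intros)
    ultimately show ?thesis unfolding F_def using X(2) by (simp add: compact_Int_closed)
  qed
  have "\<exists>d>0. \<forall>A\<in>F ` \<V>. \<forall>B\<in>F ` \<V>. A \<inter> B = {} \<longrightarrow> (\<forall>x\<in>A. \<forall>y\<in>B. d \<le> dist x y)"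
    by (rule finite_compact_family_gap) (use \<V>(1) F_compact in auto)
  then obtain d where d: "d > 0"
    "\<forall>A\<in>F ` \<V>. \<forall>B\<in>F ` \<V>. A \<inter> B = {} \<longrightarrow> (\<forall>x\<in>A. \<forall>y\<in>B. d \<le> dist x y)"
    by blast
  define \<delta> where "\<delta> = min (d / 3) (s / 2)"
  have \<delta>: "\<delta> > 0" "3 * \<delta> \<le> d" "2 * \<delta> \<le> s" using d(1) s(1) by (auto simp: \<delta>_def min_def)
  define g where "g V = (\<Union>y\<in>F V. ball y \<delta>)" for V
  have F_g: "F V \<subseteq> g V" for V using \<delta>(1) unfolding g_def by auto
  define \<G> where "\<G> = g ` {V \<in> \<V>. F V \<noteq> {}}"
  \<comment> \<open>Different V may have equal neighbourhoods, so a representative is chosen for each.\<close>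
  define h where "h G = (SOME V. V \<in> \<V> \<and> F V \<noteq> {} \<and> G = g V)" for G
  have h: "h G \<in> \<V>" "F (h G) \<noteq> {}" "G = g (h G)" if "G \<in> \<G>" for G
  proof -
    have "\<exists>V. V \<in> \<V> \<and> F V \<noteq> {} \<and> G = g V" using that unfolding \<G>_def by blast
    from someI_ex[OF this] show "h G \<in> \<V>" "F (h G) \<noteq> {}" "G = g (h G)" unfolding h_def by auto
  qed
  have apart: "d \<le> 3 * dist p q" if V: "V \<in> \<V>" "W \<in> \<V>" "F V \<inter> F W = {}" and pq: "p \<in> g V" "q \<in> g W" for V W p q
  proof -
    obtain x y where x: "x \<in> F V" "dist x p < \<delta>" and y: "y \<in> F W" "dist y q < \<delta>"
      using pq unfolding g_def by auto
    have "d \<le> dist x y" using d(2) V x(1) y(1) by blast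
    moreover have "dist x y \<le> dist x p + dist p q + dist y q"
      using dist_triangle[of x y p] dist_triangle2[of p y q] by linarith
    ultimately show ?thesis using x(2) y(2) \<delta>(2) by linarith
  qed
  have F_meet: "F V \<inter> F W \<noteq> {}" if VW: "V \<in> \<V>" "W \<in> \<V>" "g V \<inter> g W \<noteq> {}" for V W
  proof
    assume dj: "F V \<inter> F W = {}"
    obtain p where "p \<in> g V" "p \<in> g W" using VW(3) by blast
    then show False using apart[OF VW(1,2) dj, of p p] d(1) by simp
  qed
  have small: "\<exists>y\<in>X. closure (g V) \<subseteq> ball y (2 * s)" if V: "V \<in> \<V>" for V
  proof -
    obtain y where y: "y \<in> X" "V \<subseteq> ball y s" using \<V>(3)[OF V] unfolding \<C>_def by blast
    have "dist y z < 2 * s" if z: "z \<in> closure (g V)" for z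
    proof -
      obtain w where w: "w \<in> g V" "dist w z < s / 2"
        using z s(1) unfolding closure_approachable by (metis half_gt_zero)
      obtain x where x: "x \<in> F V" "dist x w < \<delta>" using w(1) unfolding g_def by auto
      have "dist y x < s" using F_sub[OF V] x(1) y(2) by auto
      then show ?thesis
        using dist_triangle[of y z x] dist_triangle[of x z w] x(2) w(2) \<delta>(3) by linarith
    qed
    then have "closure (g V) \<subseteq> ball y (2 * s)" by auto
    then show ?thesis using y(1) by blast
  qed
  have cover: "X \<subseteq> \<Union>\<G>"
  proof
    fix x assume "x \<in> X"
    then obtain V where V: "V \<in> \<V>" "x \<in> F V" using F_cover by blast
    then have "g V \<in> \<G>" "x \<in> g V" using F_g unfolding \<G>_def by blast+
    then show "x \<in> \<Union>\<G>" by blast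
  qed
  have fin: "finite \<G>" unfolding \<G>_def using \<V>(1) by simp
  have op: "open G" if "G \<in> \<G>" for G using that unfolding \<G>_def g_def by auto
  have FX: "F V \<subseteq> X" for V unfolding F_def by blast
  have meets: "G \<inter> H \<inter> X \<noteq> {}" if GH: "G \<in> \<G>" "H \<in> \<G>" "G \<inter> H \<noteq> {}" for G H
  proof -
    have "F (h G) \<inter> F (h H) \<noteq> {}"
      using F_meet[OF h(1)[OF GH(1)] h(1)[OF GH(2)]] h(3)[OF GH(1)] h(3)[OF GH(2)] GH(3) by simp
    then obtain x where x: "x \<in> F (h G)" "x \<in> F (h H)" by blast
    have "x \<in> G" "x \<in> H" "x \<in> X"
      using subsetD[OF F_g x(1)] subsetD[OF F_g x(2)] h(3)[OF GH(1)] h(3)[OF GH(2)] subsetD[OF FX x(1)] by simp_all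
    then show ?thesis by blast
  qed
  have tree: "is_tree (geometric_realization (nerve \<G>))"
  proof (rule subordinate_cover_nerve_tree[OF fin tree_imp_every_edge_bridge[OF abstract_complex_nerve \<V>(4)] X(3,1) cover])
    show "inj_on h \<G>" using h(3) by (metis inj_onI)
    fix G assume G: "G \<in> \<G>"
    show "openin (top_of_set X) (G \<inter> X)" using openin_open_Int[OF op[OF G], of X] by (simp add: Int_commute)
    show "G \<noteq> {} \<Longrightarrow> G \<inter> X \<noteq> {}" using meets[OF G G] by simp
    show "h G \<in> \<V>" by (rule h(1)[OF G])
    show "\<not> X \<subseteq> G"
    proof
      assume "X \<subseteq> G"
      then have ab': "a \<in> closure G" "b \<in> closure G" using ab closure_subset by blast+
      obtain y where "y \<in> X" "closure G \<subseteq> ball y (2 * s)" using small[OF h(1)[OF G]] h(3)[OF G] by metis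
      then have "dist y a < 2 * s" "dist y b < 2 * s" using ab' by auto
      then show False using s(3) dist_triangle3[of a b y] by linarith
    qed
    fix H assume H: "H \<in> \<G>" "G \<inter> H \<noteq> {}"
    have "F (h G) \<inter> F (h H) \<noteq> {}"
      using F_meet[OF h(1)[OF G] h(1)[OF H(1)]] h(3)[OF G] h(3)[OF H(1)] H(2) by simp
    then show "h G \<inter> h H \<noteq> {}" using F_sub[OF h(1)[OF G]] F_sub[OF h(1)[OF H(1)]] by blast
  qed
  have "fine_chain X \<G> r"
    unfolding fine_chain_def tree_chain_def
  proof (intro conjI ballI impI)
    show "finite \<G>" "X \<subseteq> \<Union>\<G>" "is_tree (geometric_realization (nerve \<G>))" by (rule fin cover tree)+
    show "open G" if "G \<in> \<G>" for G by (rule op[OF that])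
    show "\<exists>y\<in>X. closure G \<subseteq> ball y r" if G: "G \<in> \<G>" for G
    proof -
      obtain y where y: "y \<in> X" "closure G \<subseteq> ball y (2 * s)" using small[OF h(1)[OF G]] h(3)[OF G] by metis
      have "ball y (2 * s) \<subseteq> ball y r" using s(2) by (rule subset_ball)
      then show ?thesis using y by blast
    qed
    show "G \<inter> H \<inter> X \<noteq> {}" if "G \<in> \<G>" "H \<in> \<G>" "G \<inter> H \<noteq> {}" for G H by (rule meets[OF that])
    have "d / 3 \<le> dist p q" if GH: "G \<in> \<G>" "H \<in> \<G>" "G \<inter> H = {}" "p \<in> G" "q \<in> H" for G H p q
    proof -
      have "F (h G) \<subseteq> G" "F (h H) \<subseteq> H" using F_g h(3)[OF GH(1)] h(3)[OF GH(2)] by metis+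
      then have dj: "F (h G) \<inter> F (h H) = {}" using GH(3) by blast
      have "p \<in> g (h G)" "q \<in> g (h H)" using GH(4,5) h(3)[OF GH(1)] h(3)[OF GH(2)] by simp_all
      then show ?thesis using apart[OF h(1)[OF GH(1)] h(1)[OF GH(2)] dj] by fastforce
    qed
    then show "\<exists>d>0. \<forall>U\<in>\<G>. \<forall>V\<in>\<G>. U \<inter> V = {} \<longrightarrow> (\<forall>x\<in>U. \<forall>y\<in>V. d \<le> dist x y)"
      using d(1) by (intro exI[of _ "d / 3"]) simp
  qed
  then show ?thesis by blast
qed

lemma fine_chain_taut:
  assumes "fine_chain X \<U> r" shows "taut \<U>"
  unfolding taut_def
proof (intro ballI impI, rule ccontr)
  fix U V assume UV: "U \<in> \<U>" "V \<in> \<U>" "U \<inter> V = {}" and ne: "closure U \<inter> closure V \<noteq> {}"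
  obtain d where d: "d > 0" "\<And>x y. \<lbrakk>x \<in> U; y \<in> V\<rbrakk> \<Longrightarrow> d \<le> dist x y"
    using fine_chainD(5)[OF assms] UV by metis
  obtain z where z: "z \<in> closure U" "z \<in> closure V" using ne by blast
  obtain x where x: "x \<in> U" "dist x z < d / 2" using z(1) d(1) unfolding closure_approachable by (metis half_gt_zero)
  obtain y where y: "y \<in> V" "dist y z < d / 2" using z(2) d(1) unfolding closure_approachable by (metis half_gt_zero)
  show False using d(2)[OF x(1) y(1)] x(2) y(2) dist_triangle2[of x y z] by linarith
qed

lemma fine_chain_min_gap:
  assumes "fine_chain X \<U> r" obtains \<gamma> where "\<gamma> > 0" "ennreal \<gamma> \<le> min_gap \<U>"
proof -
  obtain d where d: "d > 0" "\<forall>U\<in>\<U>. \<forall>V\<in>\<U>. U \<inter> V = {} \<longrightarrow> (\<forall>x\<in>U. \<forall>y\<in>V. d \<le> dist x y)"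
    using fine_chainD(5)[OF assms] by (elim exE conjE) (rule that)
  have "ennreal d \<le> min_gap \<U>"
    unfolding min_gap_def
  proof (rule Inf_greatest)
    fix m assume "m \<in> {set_edist U V |U V. U \<in> \<U> \<and> V \<in> \<U> \<and> U \<inter> V = {}}"
    then obtain U V where UV: "m = set_edist U V" "U \<in> \<U>" "V \<in> \<U>" "U \<inter> V = {}" by blast
    show "ennreal d \<le> m" unfolding UV(1) set_edist_def
    proof (intro INF_greatest)
      fix x y assume "x \<in> U" "y \<in> V"
      then show "ennreal d \<le> ennreal (dist x y)" using d(2) UV(2-4) by (intro ennreal_leI) blast
    qed
  qed
  with d(1) show thesis by (rule that)
qed

lemma fine_chain_mesh:
  assumes "fine_chain X \<U> r" shows "mesh \<U> \<le> ennreal (2 * r)"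
  unfolding mesh_def ediameter_def
proof (intro SUP_least ennreal_leI)
  fix U x y assume U: "U \<in> \<U>" and xy: "x \<in> U" "y \<in> U"
  obtain c where "closure U \<subseteq> ball c r" using fine_chainD(3)[OF assms] U by blast
  then have "dist c x < r" "dist c y < r" using xy closure_subset[of U] by auto
  then show "dist x y \<le> 2 * r" using dist_triangle3[of x y c] by linarith
qed

lemma common_Lebesgue_number:
  fixes X :: "'a::heine_borel set"
  assumes X: "compact X" and f: "continuous_on X f" "f ` X \<subseteq> X"
    and \<U>: "X \<subseteq> \<Union>\<U>" "\<And>U. U \<in> \<U> \<Longrightarrow> open U"
  obtains e where "e > 0" "\<And>y. y \<in> X \<Longrightarrow> \<exists>U\<in>\<U>. ball y e \<subseteq> U"
    "\<And>y. y \<in> X \<Longrightarrow> \<exists>U\<in>\<U>. f ` (X \<inter> ball y e) \<subseteq> U"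
proof -
  obtain e1 where e1: "e1 > 0" "\<And>y. y \<in> X \<Longrightarrow> \<exists>U\<in>\<U>. ball y e1 \<subseteq> U"
    using Heine_Borel_lemma[OF X \<U>] by metis
  have "uniformly_continuous_on X f" by (rule compact_uniformly_continuous[OF f(1) X])
  then obtain e2 where e2: "e2 > 0" "\<And>x y. \<lbrakk>x \<in> X; y \<in> X; dist y x < e2\<rbrakk> \<Longrightarrow> dist (f y) (f x) < e1"
    using e1(1) unfolding uniformly_continuous_on_def by metis
  show thesis
  proof (rule that[of "min e1 e2"])
    show "min e1 e2 > 0" using e1 e2 by simp
    fix y assume y: "y \<in> X"
    show "\<exists>U\<in>\<U>. ball y (min e1 e2) \<subseteq> U"
    proof -
      obtain U where U: "U \<in> \<U>" "ball y e1 \<subseteq> U" using e1(2)[OF y] by (elim bexE) (rule that)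
      have "ball y (min e1 e2) \<subseteq> U" by (rule order_trans[OF subset_ball U(2)]) simp
      then show ?thesis using U(1) by (intro bexI)
    qed
    have "f y \<in> X" using f(2) y by blast
    from e1(2)[OF this] obtain U where U: "U \<in> \<U>" "ball (f y) e1 \<subseteq> U" by (elim bexE) (rule that)
    have "f ` (X \<inter> ball y (min e1 e2)) \<subseteq> U"
    proof
      fix z assume "z \<in> f ` (X \<inter> ball y (min e1 e2))"
      then obtain x where x: "z = f x" "x \<in> X" "dist y x < e2" by auto
      have "dist (f y) (f x) < e1" using e2(2)[OF x(2) y x(3)] .
      then show "z \<in> U" using U(2) x(1) by auto
    qed
    then show "\<exists>U\<in>\<U>. f ` (X \<inter> ball y (min e1 e2)) \<subseteq> U" using U(1) by (intro bexI)
  qed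
qed

text \<open>
  Choose the chains so fine that \<open>f\<close> maps the part of \<open>X\<close> near a link \<open>V\<close> of chain \<open>n + 1\<close> into one link of
  chain \<open>n\<close>, and let \<open>\<phi> n V\<close> be such a link. Two links of one chain that meet have a common point of \<open>X\<close>,
  whose image lies in both image links; this is the third pattern condition. Links \<open>U\<close> and \<open>V\<close> of
  consecutive chains may meet only outside \<open>X\<close>, but then each point of \<open>X\<close> in \<open>U\<close> is near
  \<open>V\<close>; this is why a neighbourhood of \<open>V\<close> is mapped into \<open>\<phi> n V\<close>. The first condition holds since \<open>f\<close> moves
  all points farther than a few links of the first chain reach.
\<close>

lemma fixed_point_free_sequence_exists:
  fixes X :: "'a::heine_borel set"
  assumes tl: "tree_like_continuum X" and nofp: "\<not> fixed_point_property X"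
  shows "\<exists>\<U> :: nat \<Rightarrow> 'a set set. fixed_point_free_tree_chain_sequence \<U>"
proof -
  have X: "X \<noteq> {}" "compact X"
    using tl unfolding tree_like_continuum_def continuum_def by blast+
  obtain f where f: "continuous_on X f" "f ` X \<subseteq> X" "\<And>p. p \<in> X \<Longrightarrow> f p \<noteq> p"
    using nofp unfolding fixed_point_property_def by blast
  obtain a where a: "a \<in> X" using X(1) by blast
  have fa: "f a \<in> X" "a \<noteq> f a" using f(2) f(3)[OF a] a by (blast, simp)
  have "continuous_on X (\<lambda>x. dist (f x) x)" using f(1) by (intro continuous_intros)
  then obtain m where m: "m \<in> X" "\<And>x. x \<in> X \<Longrightarrow> dist (f m) m \<le> dist (f x) x"
    using continuous_attains_inf[OF X(2,1)] by blast
  \<comment> \<open>If \<phi> 1 V met a link U that meets V, then f would move some point of V by less than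
    the length of three links, each of diameter at most 2 * r0.\<close>
  define r0 where "r0 = dist (f m) m / 6"
  have r0: "r0 > 0" using f(3)[OF m(1)] unfolding r0_def by simp
  have moves: "6 * r0 \<le> dist (f x) x" if "x \<in> X" for x using m(2)[OF that] unfolding r0_def by simp
  obtain \<U>0 where \<U>0: "fine_chain X \<U>0 r0"
    using fine_chain_exists[OF tl a fa(1) fa(2) r0] by blast
  obtain \<gamma> where \<gamma>: "\<gamma> > 0" "ennreal \<gamma> \<le> min_gap \<U>0" using fine_chain_min_gap[OF \<U>0] by blast
  \<comment> \<open>A pair s consists of a chain and the radius of its links; the chain with index n in the
    recursion has index n + 1 in the resulting sequence.\<close>
  define P where "P n s \<longleftrightarrow> fine_chain X (fst s) (snd s) \<and> 0 < snd s \<and>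
      (n = 0 \<longrightarrow> s = (\<U>0, r0)) \<and> (n > 0 \<longrightarrow> snd s < \<gamma> / 2 ^ (n + 2))" for n :: nat and s
  \<comment> \<open>A link of the next chain that meets a link V lies within three radii of the centre of V, so
    five radii are more than enough for the second pattern condition.\<close>
  define Q where "Q n s t \<longleftrightarrow> snd t \<le> snd s \<and>
      (\<forall>y\<in>X. (\<exists>U\<in>fst s. ball y (5 * snd t) \<subseteq> U) \<and> (\<exists>U\<in>fst s. f ` (X \<inter> ball y (5 * snd t)) \<subseteq> U))"
    for n :: nat and s t :: "'a set set \<times> real"
  have "\<exists>S. \<forall>n. P n (S n) \<and> Q n (S n) (S (Suc n))"
  proof (rule dependent_nat_choice)
    show "\<exists>s. P 0 s" using \<U>0 r0 unfolding P_def by auto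
    fix s n assume s: "P n s"
    then have fs: "fine_chain X (fst s) (snd s)" "0 < snd s" unfolding P_def by auto
    have \<U>: "X \<subseteq> \<Union>(fst s)" "\<And>U. U \<in> fst s \<Longrightarrow> open U"
      using fine_chainD(1,2)[OF fs(1)] unfolding tree_chain_def by blast+
    obtain e where e: "e > 0" "\<And>y. y \<in> X \<Longrightarrow> \<exists>U\<in>fst s. ball y e \<subseteq> U"
      "\<And>y. y \<in> X \<Longrightarrow> \<exists>U\<in>fst s. f ` (X \<inter> ball y e) \<subseteq> U"
      using common_Lebesgue_number[OF X(2) f(1,2) \<U>] by metis
    define r where "r = min (min (e / 5) (snd s)) (\<gamma> / 2 ^ (Suc n + 3))"
    have "r \<le> e / 5" "r \<le> snd s" unfolding r_def by linarith+
    moreover have "r > 0" unfolding r_def using e(1) fs(2) \<gamma>(1) by simp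
    ultimately have r: "r > 0" "5 * r \<le> e" "r \<le> snd s" by simp_all
    have "r \<le> \<gamma> / 2 ^ (Suc n + 3)" unfolding r_def by simp
    also have "\<dots> < \<gamma> / 2 ^ (Suc n + 2)"
      using \<gamma>(1) by (intro divide_strict_left_mono power_strict_increasing) auto
    finally have r\<gamma>: "r < \<gamma> / 2 ^ (Suc n + 2)" .
    obtain \<U>' where \<U>': "fine_chain X \<U>' r" using fine_chain_exists[OF tl a fa(1) fa(2) r(1)] by blast
    have sub: "ball y (5 * r) \<subseteq> ball y e" for y using r(2) by (rule subset_ball)
    have "P (Suc n) (\<U>', r)" unfolding P_def using \<U>' r(1) r\<gamma> by simp
    moreover have "Q n s (\<U>', r)" unfolding Q_def snd_conv
    proof (intro conjI ballI)
      show "r \<le> snd s" by (rule r(3))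
      fix y assume y: "y \<in> X"
      show "\<exists>U\<in>fst s. ball y (5 * r) \<subseteq> U" using e(2)[OF y] sub by (meson order_trans)
      have "f ` (X \<inter> ball y (5 * r)) \<subseteq> f ` (X \<inter> ball y e)" using sub by blast
      then show "\<exists>U\<in>fst s. f ` (X \<inter> ball y (5 * r)) \<subseteq> U" using e(3)[OF y] by (meson order_trans)
    qed
    ultimately show "\<exists>t. P (Suc n) t \<and> Q n s t" by blast
  qed
  then obtain S where S: "\<And>n. P n (S n)" "\<And>n. Q n (S n) (S (Suc n))" by blast
  define \<U> where "\<U> n = fst (S (n - 1))" for n
  define r where "r n = snd (S (n - 1))" for n
  have fine: "fine_chain X (\<U> n) (r n)" for n using S(1) unfolding P_def \<U>_def r_def by blast
  have U1: "\<U> 1 = \<U>0" "r 1 = r0" using S(1)[of 0] unfolding P_def \<U>_def r_def by simp_all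
  have r_small: "r n < \<gamma> / 2 ^ (n + 1)" if "n \<ge> 2" for n
    using S(1)[of "n - 1"] that unfolding P_def r_def by (auto simp: Suc_diff_le numeral_2_eq_2)
  have Qn: "r (Suc n) \<le> r n"
      "\<And>y. y \<in> X \<Longrightarrow> \<exists>U\<in>\<U> n. ball y (5 * r (Suc n)) \<subseteq> U"
      "\<And>y. y \<in> X \<Longrightarrow> \<exists>U\<in>\<U> n. f ` (X \<inter> ball y (5 * r (Suc n))) \<subseteq> U" if "n \<ge> 1" for n
    using S(2)[of "n - 1"] that unfolding Q_def \<U>_def r_def by simp_all
  have r_pos: "r n > 0" for n using S(1) unfolding P_def r_def by blast
  define cen where "cen n V = (SOME y. y \<in> X \<and> closure V \<subseteq> ball y (r n))" for n V
  have cen: "cen n V \<in> X" "closure V \<subseteq> ball (cen n V) (r n)" if "V \<in> \<U> n" for n V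
  proof -
    have "\<exists>y. y \<in> X \<and> closure V \<subseteq> ball y (r n)" using fine_chainD(3)[OF fine[of n]] that by blast
    from someI_ex[OF this] show "cen n V \<in> X" "closure V \<subseteq> ball (cen n V) (r n)" unfolding cen_def by auto
  qed
  have cen_dist: "dist (cen n V) x < r n" if "V \<in> \<U> n" "x \<in> V" for n V x
    using cen(2)[OF that(1)] that(2) closure_subset[of V] by auto
  define \<phi> where "\<phi> n V = (SOME U. U \<in> \<U> n \<and> f ` (X \<inter> ball (cen (Suc n) V) (5 * r (Suc n))) \<subseteq> U)" for n V
  have \<phi>: "\<phi> n V \<in> \<U> n" "f ` (X \<inter> ball (cen (Suc n) V) (5 * r (Suc n))) \<subseteq> \<phi> n V"
    if "n \<ge> 1" "V \<in> \<U> (Suc n)" for n V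
  proof -
    have "\<exists>U. U \<in> \<U> n \<and> f ` (X \<inter> ball (cen (Suc n) V) (5 * r (Suc n))) \<subseteq> U"
      using Qn(3)[OF that(1) cen(1)[OF that(2)]] by blast
    from someI_ex[OF this] show "\<phi> n V \<in> \<U> n" "f ` (X \<inter> ball (cen (Suc n) V) (5 * r (Suc n))) \<subseteq> \<phi> n V"
      unfolding \<phi>_def by auto
  qed
  have f_in: "f x \<in> \<phi> n V" if "n \<ge> 1" "V \<in> \<U> (Suc n)" "x \<in> X" "dist (cen (Suc n) V) x < 5 * r (Suc n)" for n V x
    using \<phi>(2)[OF that(1,2)] that(3,4) by auto
  have f_in': "f x \<in> \<phi> n V" if "n \<ge> 1" "V \<in> \<U> (Suc n)" "x \<in> X" "x \<in> V" for n V x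
    using f_in[OF that(1-3)] cen_dist[OF that(2,4)] r_pos[of "Suc n"] by simp
  have meetX: "\<exists>x\<in>X. x \<in> U \<and> x \<in> V" if "U \<in> \<U> n" "V \<in> \<U> n" "U \<inter> V \<noteq> {}" for n U V
    using fine_chainD(4)[OF fine[of n]] that by blast
  have diam: "dist x y < 2 * r n" if "U \<in> \<U> n" "x \<in> U" "y \<in> U" for n U x y
    using cen_dist[OF that(1,2)] cen_dist[OF that(1,3)] dist_triangle3[of x y "cen n U"] by linarith
  have "follows_fixed_point_free_pattern \<U>"
    unfolding follows_fixed_point_free_pattern_def
  proof (intro exI[of _ \<phi>] conjI allI impI ballI)
    show "\<phi> n V \<in> \<U> n" if "1 \<le> n" "V \<in> \<U> (n + 1)" for n V using \<phi>(1)[of n V] that by simp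
    show "\<phi> 1 V \<inter> U = {}" if U: "U \<in> \<U> 1" and V: "V \<in> \<U> 2" and UV: "U \<inter> V \<noteq> {}" for U V
    proof (rule ccontr)
      assume "\<phi> 1 V \<inter> U \<noteq> {}"
      then obtain q where q: "q \<in> \<phi> 1 V" "q \<in> U" by blast
      have V2: "V \<in> \<U> (Suc 1)" using V by (simp add: numeral_2_eq_2)
      obtain p where p: "p \<in> U" "p \<in> V" using UV by blast
      obtain x where x: "x \<in> X" "x \<in> V" using meetX[OF V V] p(2) by blast
      have "dist (f x) q < 2 * r0"
        using diam[OF \<phi>(1)[OF _ V2] f_in'[OF _ V2 x] q(1)] U1(2) by simp
      moreover have "dist q p < 2 * r0" using diam[OF U q(2) p(1)] U1(2) by simp
      moreover have "dist p x < 2 * r0"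
        using diam[OF V2 p(2) x(2)] Qn(1)[of 1] U1(2) by simp
      ultimately have "dist (f x) x < 6 * r0"
        using dist_triangle[of "f x" x q] dist_triangle[of q x p] by linarith
      then show False using moves[OF x(1)] by simp
    qed
    show "\<phi> (n + 1) U \<inter> \<phi> n V \<noteq> {}"
      if n: "1 \<le> n" and U: "U \<in> \<U> (n + 2)" and V: "V \<in> \<U> (n + 1)" and UV: "U \<inter> V \<noteq> {}" for n U V
    proof -
      have U': "U \<in> \<U> (Suc (Suc n))" and V': "V \<in> \<U> (Suc n)" using U V by simp_all
      obtain p where p: "p \<in> U" "p \<in> V" using UV by blast
      obtain x where x: "x \<in> X" "x \<in> U" using meetX[OF U' U'] p(1) by blast
      have "dist (cen (Suc n) V) p < r (Suc n)" by (rule cen_dist[OF V' p(2)])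
      moreover have "dist p x < 2 * r (Suc n)"
        using diam[OF U' p(1) x(2)] Qn(1)[of "Suc n"] by simp
      ultimately have "dist (cen (Suc n) V) x < 5 * r (Suc n)"
        using dist_triangle[of "cen (Suc n) V" x p] r_pos[of "Suc n"] by linarith
      then have "f x \<in> \<phi> n V" by (rule f_in[OF n V' x(1)])
      moreover have "f x \<in> \<phi> (Suc n) U" using f_in'[OF _ U' x] by simp
      ultimately show ?thesis by auto
    qed
    show "\<phi> n U \<inter> \<phi> n V \<noteq> {}"
      if n: "1 \<le> n" and U: "U \<in> \<U> (n + 1)" and V: "V \<in> \<U> (n + 1)" and UV: "U \<inter> V \<noteq> {}" for n U V
    proof -
      obtain x where x: "x \<in> X" "x \<in> U" "x \<in> V" using meetX[OF U V UV] by blast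
      have "f x \<in> \<phi> n U" "f x \<in> \<phi> n V" using f_in'[of n] n U V x by simp_all
      then show ?thesis by blast
    qed
  qed
  moreover have "strongly_refines (\<U> (n + 1)) (\<U> n)" if n: "n \<ge> 1" for n
    unfolding strongly_refines_def
  proof
    fix V assume "V \<in> \<U> (n + 1)"
    then have V: "V \<in> \<U> (Suc n)" by simp
    obtain U where U: "U \<in> \<U> n" "ball (cen (Suc n) V) (5 * r (Suc n)) \<subseteq> U"
      using Qn(2)[OF n cen(1)[OF V]] by blast
    have "r (Suc n) \<le> 5 * r (Suc n)" using r_pos[of "Suc n"] by simp
    then have "closure V \<subseteq> U" using cen(2)[OF V] subset_ball U(2) by (meson order_trans)
    then show "\<exists>U\<in>\<U> n. closure V \<subseteq> U" using U(1) by blast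
  qed
  moreover have "mesh (\<U> n) < min_gap (\<U> 1) / 2 ^ n" if n: "n \<ge> 2" for n
  proof -
    have pow: "(2::ennreal) ^ n = ennreal (2 ^ n)" by (simp add: ennreal_power flip: ennreal_numeral)
    have "2 * r n < \<gamma> / 2 ^ n" using r_small[OF n] by (simp add: field_simps)
    then have "ennreal (2 * r n) < ennreal (\<gamma> / 2 ^ n)" using r_pos[of n] by (intro ennreal_lessI) auto
    also have "\<dots> = ennreal \<gamma> / 2 ^ n" unfolding pow using \<gamma>(1) by (simp add: divide_ennreal)
    also have "\<dots> \<le> min_gap (\<U> 1) / 2 ^ n" unfolding U1(1) by (intro divide_right_mono_ennreal \<gamma>(2))
    finally show ?thesis using fine_chain_mesh[OF fine[of n]] by (rule order_le_less_trans[rotated])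
  qed
  moreover have "tree_chain (\<U> n)" "taut (\<U> n)" for n
    by (rule fine_chainD(1)[OF fine], rule fine_chain_taut[OF fine])
  ultimately show ?thesis
    unfolding fixed_point_free_tree_chain_sequence_def by blast
qed

section \<open>The correspondence for planar continua\<close>

theorem corollary3p3:
  "(\<forall>\<U> :: nat \<Rightarrow> (real ^ 2) set set.
      fixed_point_free_tree_chain_sequence \<U> \<longrightarrow>
        tree_like_continuum (\<Inter>n\<in>{1..}. \<Union>(\<U> n)) \<and>
        \<not> fixed_point_property (\<Inter>n\<in>{1..}. \<Union>(\<U> n))) \<and>
   ((\<nexists>\<U> :: nat \<Rightarrow> (real ^ 2) set set. fixed_point_free_tree_chain_sequence \<U>) \<longrightarrow>
      (\<forall>X :: (real ^ 2) set. tree_like_continuum X \<longrightarrow> fixed_point_property X))"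
proof (intro conjI allI impI)
  fix \<U> :: "nat \<Rightarrow> (real ^ 2) set set"
  assume "fixed_point_free_tree_chain_sequence \<U>"
  then show "tree_like_continuum (\<Inter>n\<in>{1..}. \<Union>(\<U> n))" "\<not> fixed_point_property (\<Inter>n\<in>{1..}. \<Union>(\<U> n))"
    by (rule fixed_point_free_sequence_intersection)+
next
  fix X :: "(real ^ 2) set"
  assume "\<nexists>\<U> :: nat \<Rightarrow> (real ^ 2) set set. fixed_point_free_tree_chain_sequence \<U>" "tree_like_continuum X"
  then show "fixed_point_property X"
    using fixed_point_free_sequence_exists[of X] by blast
qed

end
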